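(* Let the setting, notation and standing assumptions be those of the context. Suppose that: (b) the pair $(A(x),B)$ is stabilizable for every $x\in\Omega$; (c) the pair $(A(x),Q^{1/2})$ is detectable for every $x\in\Omega$; (e) $\|A(x)-A(y)\|\le L_A\|x-y\|$ for all $x,y\in\Omega$, with $L_A>0$; (f) $\operatorname{logm}(A_{cl}(y))+\operatorname{logm}\big((\nabla A_{cl}(y))\,y\big)<0$ for all $y\in\Omega$. Let $\mu\in\mathcal P$, $t\ge0$, and let the timestep $\Delta t>0$ satisfy $$\Delta t<\frac{1}{2L_A\,\|A_{cl}(y_{\mu,0})\,y_{\mu,0}\|\,\|H_{\mu,t}\|}.$$ Then $A_{\mu,t+\Delta t}-FP_{\mu,t}$ is stable. Moreover, the Newton--Kleinman sequence $\{P^j_{\mu,t+\Delta t}\}_{j\ge0}$ for the parameter $\mu$ at time $t+\Delta t$ with initial guess $P^0_{\mu,t+\Delta t}=P_{\mu,t}$ converges to the unique symmetric positive semidefinite solution $P_{\mu,t+\Delta t}$ of the Riccati equation $$A_{\mu,t+\Delta t}^\top P+PA_{\mu,t+\Delta t}-PFP+Q=0.$$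
   Context: Let $d,m\in\mathbb N$, $\Omega\subset\mathbb R^d$ a domain, $\mathcal P$ a parameter set. $\|\cdot\|$ is the Euclidean norm for vectors and the operator 2-norm for matrices. Let $A:\mathbb R^d\to\mathbb R^{d\times d}$ be a matrix function, $B\in\mathbb R^{d\times m}$, $Q\in\mathbb R^{d\times d}$ symmetric positive semidefinite, $R\in\mathbb R^{m\times m}$ symmetric positive definite, and $F=BR^{-1}B^\top$. A real square matrix is stable if all its eigenvalues lie in the open left half plane. A pair $(A,B)$ is stabilizable if there is a matrix $K$ such that $A-BK$ is stable; $(A,C)$ is detectable if $(A^\top,C^\top)$ is stabilizable. For $y\in\Omega$, $P(y)$ denotes the unique symmetric positive semidefinite solution of the State-Dependent Riccati Equation $A(y)^\top P(y)+P(y)A(y)-P(y)FP(y)+Q=0$, which exists under stabilizability of $(A(y),B)$ and detectability of $(A(y),Q^{1/2})$ and for which $A(y)-FP(y)$ is stable. The closed-loop matrix is $A_{cl}(y)=A(y)-FP(y)$, assumed differentiable on $\Omega$, and $(\nabla A_{cl}(y))\,y\in\mathbb R^{d\times d}$ denotes the matrix whose $i$-th column is $\left[\frac{\partial}{\partial y_i}A_{cl}(y)\right]y$, $i=1,\dots,d$. For $\mu\in\mathcal P$ and initial datum $y_0(\mu)\in\Omega$, $y(\cdot;\mu)$ is the solution of $\dot y(t;\mu)=A_{cl}(y(t;\mu))\,y(t;\mu)$, $y(0;\mu)=y_0(\mu)$; the trajectory is assumed to exist and remain in $\Omega$ on the times considered. Notation: $y_{\mu,t}=y(t;\mu)$,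 $A_{\mu,t}=A(y_{\mu,t})$, $P_{\mu,t}=P(y_{\mu,t})$. The matrix $H_{\mu,t}$ is the solution of the Lyapunov equation $$(A_{\mu,t}-FP_{\mu,t})^\top H_{\mu,t}+H_{\mu,t}(A_{\mu,t}-FP_{\mu,t})=-I.$$ The logarithmic norm of $M\in\mathbb C^{d\times d}$ is $\operatorname{logm}(M)=\sup_{x\in\mathbb C^d\setminus\{0\}}\operatorname{Re}((Mx)\cdot x)/\|x\|^2$, where $\cdot$ is the standard Hermitian inner product. Newton--Kleinman sequence at $(\mu,t)$ with initial guess $P^0_{\mu,t}$: given $P^k_{\mu,t}$, set $A^k_{cl}=A_{\mu,t}-FP^k_{\mu,t}$ and let $P^{k+1}_{\mu,t}$ be the solution of the Lyapunov equation $(A^k_{cl})^\top P^{k+1}_{\mu,t}+P^{k+1}_{\mu,t}A^k_{cl}=-P^k_{\mu,t}FP^k_{\mu,t}-Q$. If $A_{cl}(y_{\mu,0})y_{\mu,0}=0$, the bound on $\Delta t$ is understood as no restriction. *)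

theory Defs
  imports "HOL-Analysis.Analysis"
begin

text \<open>The norm of the type \<open>real ^ 'n ^ 'n\<close> is the Frobenius norm, so the operator 2-norm needs
  its own name.\<close>
definition op_norm :: "real ^ 'n ^ 'm \<Rightarrow> real" where
  "op_norm M = onorm (\<lambda>x. M *v x)"

definition symmetric_mat :: "real ^ 'n ^ 'n \<Rightarrow> bool" where
  "symmetric_mat M \<longleftrightarrow> transpose M = M"

definition sym_psd :: "real ^ 'n ^ 'n \<Rightarrow> bool" where
  "sym_psd M \<longleftrightarrow> symmetric_mat M \<and> (\<forall>x. 0 \<le> x \<bullet> (M *v x))"

definition sym_pd :: "real ^ 'n ^ 'n \<Rightarrow> bool" where
  "sym_pd M \<longleftrightarrow> symmetric_mat M \<and> (\<forall>x. x \<noteq> 0 \<longrightarrow> 0 < x \<bullet> (M *v x))"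

definition psd_sqrt :: "real ^ 'n ^ 'n \<Rightarrow> real ^ 'n ^ 'n" where
  "psd_sqrt M = (THE S. sym_psd S \<and> S ** S = M)"

abbreviation complex_mat :: "real ^ 'n ^ 'm \<Rightarrow> complex ^ 'n ^ 'm" where
  "complex_mat M \<equiv> map_matrix complex_of_real M"

definition eigenvalue :: "complex ^ 'n ^ 'n \<Rightarrow> complex \<Rightarrow> bool" where
  "eigenvalue M z \<longleftrightarrow> (\<exists>v. v \<noteq> 0 \<and> M *v v = z *s v)"

definition stable :: "real ^ 'n ^ 'n \<Rightarrow> bool" where
  "stable M \<longleftrightarrow> (\<forall>z. eigenvalue (complex_mat M) z \<longrightarrow> Re z < 0)"

definition stabilizable :: "real ^ 'n ^ 'n \<Rightarrow> real ^ 'm ^ 'n \<Rightarrow> bool" where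
  "stabilizable A B \<longleftrightarrow> (\<exists>K :: real ^ 'n ^ 'm. stable (A - B ** K))"

definition detectable :: "real ^ 'n ^ 'n \<Rightarrow> real ^ 'n ^ 'p \<Rightarrow> bool" where
  "detectable A C \<longleftrightarrow> stabilizable (transpose A) (transpose C)"

definition hermitian_inner :: "complex ^ 'n \<Rightarrow> complex ^ 'n \<Rightarrow> complex" where
  "hermitian_inner x y = (\<Sum>i\<in>UNIV. x $ i * cnj (y $ i))"

definition logm :: "complex ^ 'n ^ 'n \<Rightarrow> real" where
  "logm M = (SUP x\<in>UNIV - {0}. Re (hermitian_inner (M *v x) x) / (norm x)\<^sup>2)"

definition partial_deriv ::
    "'n \<Rightarrow> (real ^ 'n \<Rightarrow> 'b::real_normed_vector) \<Rightarrow> real ^ 'n \<Rightarrow> 'b" where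
  "partial_deriv i f y = vector_derivative (\<lambda>s. f (y + s *\<^sub>R axis i 1)) (at 0)"

text \<open>The matrix \<open>(\<nabla>M(y)) y\<close>, whose \<open>i\<close>-th column is \<open>(\<partial>M/\<partial>y\<^sub>i)(y) y\<close>.\<close>
definition grad_apply :: "(real ^ 'n \<Rightarrow> real ^ 'n ^ 'n) \<Rightarrow> real ^ 'n \<Rightarrow> real ^ 'n ^ 'n" where
  "grad_apply M y = (\<chi> k i. (partial_deriv i M y *v y) $ k)"

definition lyapunov_eq :: "real ^ 'n ^ 'n \<Rightarrow> real ^ 'n ^ 'n \<Rightarrow> real ^ 'n ^ 'n \<Rightarrow> bool" where
  "lyapunov_eq M W X \<longleftrightarrow> transpose M ** X + X ** M = - W"

definition lyapunov_sol :: "real ^ 'n ^ 'n \<Rightarrow> real ^ 'n ^ 'n \<Rightarrow> real ^ 'n ^ 'n" where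
  "lyapunov_sol M W = (THE X. lyapunov_eq M W X)"

definition riccati_psd ::
    "real ^ 'n ^ 'n \<Rightarrow> real ^ 'n ^ 'n \<Rightarrow> real ^ 'n ^ 'n \<Rightarrow> real ^ 'n ^ 'n \<Rightarrow> bool" where
  "riccati_psd A F Q X \<longleftrightarrow>
     sym_psd X \<and> transpose A ** X + X ** A - X ** F ** X + Q = 0"

definition riccati_sol ::
    "real ^ 'n ^ 'n \<Rightarrow> real ^ 'n ^ 'n \<Rightarrow> real ^ 'n ^ 'n \<Rightarrow> real ^ 'n ^ 'n" where
  "riccati_sol A F Q = (THE X. riccati_psd A F Q X)"

primrec newton_kleinman ::
    "real ^ 'n ^ 'n \<Rightarrow> real ^ 'n ^ 'n \<Rightarrow> real ^ 'n ^ 'n \<Rightarrow> real ^ 'n ^ 'n \<Rightarrow> nat \<Rightarrow> real ^ 'n ^ 'n"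
where
  "newton_kleinman A F Q P\<^sub>0 0 = P\<^sub>0"
| "newton_kleinman A F Q P\<^sub>0 (Suc k) =
     (let P = newton_kleinman A F Q P\<^sub>0 k in lyapunov_sol (A - F ** P) (P ** F ** P + Q))"

end

theory Submission
  imports Defs "HOL-Computational_Algebra.Fundamental_Theorem_Algebra"
begin

text \<open>
  The closed-loop matrix at time \<open>t + \<Delta>t\<close> with the old gain is a perturbation of the stable matrix
  \<open>A\<^sub>\<mu>\<^sub>,\<^sub>t - F P\<^sub>\<mu>\<^sub>,\<^sub>t\<close> by \<open>A\<^sub>\<mu>\<^sub>,\<^sub>t\<^sub>+\<^sub>\<Delta>\<^sub>t - A\<^sub>\<mu>\<^sub>,\<^sub>t\<close>. By the Lipschitz condition the perturbation is at most \<open>L\<^sub>A\<close> times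
  the distance travelled, and the distance travelled is at most \<open>\<Delta>t\<close> times the initial speed: the
  velocity \<open>v\<close> solves a linear equation whose matrix is \<open>A\<^sub>c\<^sub>l(y) + (\<nabla>A\<^sub>c\<^sub>l(y)) y\<close>, so the condition on
  the logarithmic norms makes \<open>\<bar>v\<bar>\<close> nonincreasing (\<open>velocity_norm_le\<close>). The bound on the timestep
  is what keeps \<open>H\<close> a Lyapunov matrix for the perturbed loop (\<open>stable_perturbation\<close>). Hence
  \<open>P\<^sub>\<mu>\<^sub>,\<^sub>t\<close> is a stabilizing initial guess, and the rest is Kleinman's theorem: from such a guess
  all closed loops are stable and the iterates decrease to a positive semidefinite solution
  of the Riccati equation (\<open>newton_kleinman_converges\<close>), which is unique by detectability
  (\<open>riccati_unique\<close>).

  Everything rests on two facts about the Lyapunov equation \<open>M\<^sup>T X + X M = -W\<close>. If \<open>M\<close> is stable, the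
  solution exists, is unique, and is positive semidefinite whenever \<open>W\<close> is. Instead of the integral
  of \<open>exp (t M\<^sup>T) W exp (t M)\<close>, the proof uses the Cayley transform of \<open>M\<close>, whose powers tend to zero
  since its spectrum lies in the unit disc (\<open>funpow_matrix_tendsto_0\<close>). Conversely, a positive
  semidefinite solution \<open>X\<close> for a semidefinite \<open>W\<close> shows that \<open>M\<close> is stable as soon as \<open>M\<close> agrees with
  some stable matrix wherever the form of \<open>W\<close> vanishes (\<open>stable_transfer\<close>). This one
  criterion yields stability under small perturbations, along the Newton--Kleinman iteration,
  and of the Riccati closed loop.

  The existence of the Riccati solution and of the square root in the detectability hypothesis are
  themselves consequences of the convergence of the iteration (\<open>riccati_exists\<close>,
  \<open>ex_sym_psd_sqrt\<close>).
\<close>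

section \<open>Matrices as bilinear forms\<close>

text \<open>Products with a transposed matrix are moved across the inner product below; the simplifier
would instead turn them into vector-matrix products.\<close>

declare transpose_matrix_vector [simp del] vector_transpose_matrix [simp del]

lemma inner_transpose:
  fixes A :: "real ^ 'n ^ 'm"
  shows "x \<bullet> (transpose A *v y) = (A *v x) \<bullet> y"
  by (metis dot_lmul_matrix inner_commute transpose_matrix_vector)

lemma matrix_vector_mult_minus_left: "(- A) *v x = - (A *v x)"
  for A :: "'a::comm_ring_1 ^ 'n ^ 'm"
  by (simp add: vec_eq_iff matrix_vector_mult_def sum_negf)

text \<open>Matrix identities involving transposes and symmetric matrices are proved by comparing the
  bilinear forms of both sides: these rules push every product and sum outwards to inner products
  of vectors, where the identity is linear.\<close>

lemmas form_simps = inner_transpose matrix_vector_mul_assoc[symmetric]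
  matrix_vector_mult_add_rdistrib matrix_vector_mult_diff_rdistrib matrix_vector_mult_minus_left
  matrix_vector_right_distrib matrix_vector_mult_diff_distrib
  inner_add_left inner_add_right inner_diff_left inner_diff_right

lemma matrix_eq_iff_form:
  fixes A B :: "real ^ 'n ^ 'm"
  shows "A = B \<longleftrightarrow> (\<forall>x y. x \<bullet> (A *v y) = x \<bullet> (B *v y))"
  by (metis matrix_eq vector_eq_rdot inner_commute)

lemma symmetric_mat_iff_form:
  "symmetric_mat X \<longleftrightarrow> (\<forall>x y. (X *v x) \<bullet> y = x \<bullet> (X *v y))"
  by (auto simp: symmetric_mat_def matrix_eq_iff_form inner_transpose)

lemma sym_psd_symD: "sym_psd X \<Longrightarrow> (X *v x) \<bullet> y = x \<bullet> (X *v y)"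
  by (simp add: sym_psd_def symmetric_mat_iff_form)

lemma sym_psd_nonneg: "sym_psd X \<Longrightarrow> 0 \<le> x \<bullet> (X *v x)"
  by (simp add: sym_psd_def)

lemma sym_psdI:
  "(\<And>x y. (X *v x) \<bullet> y = x \<bullet> (X *v y)) \<Longrightarrow> (\<And>x. 0 \<le> x \<bullet> (X *v x)) \<Longrightarrow> sym_psd X"
  by (simp add: sym_psd_def symmetric_mat_iff_form)

lemma sym_psd_add: "sym_psd X \<Longrightarrow> sym_psd Y \<Longrightarrow> sym_psd (X + Y)"
  by (rule sym_psdI) (simp_all add: form_simps sym_psd_symD sym_psd_nonneg)

lemma sym_psd_mat1: "sym_psd (mat 1)"
  by (rule sym_psdI) auto

lemma sym_psd_congruence: "sym_psd W \<Longrightarrow> sym_psd (transpose T ** W ** T)"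
  for T :: "real ^ 'n ^ 'm"
proof (rule sym_psdI)
  assume W: "sym_psd W"
  show "((transpose T ** W ** T) *v x) \<bullet> y = x \<bullet> ((transpose T ** W ** T) *v y)" for x y
    by (simp add: form_simps inner_commute[of _ y] sym_psd_symD[OF W])
      (metis W inner_commute sym_psd_symD)
  show "0 \<le> x \<bullet> ((transpose T ** W ** T) *v x)" for x
    using sym_psd_nonneg[OF W] by (simp add: form_simps)
qed

lemma sym_psd_congruence_sym:
  "sym_psd W \<Longrightarrow> symmetric_mat T \<Longrightarrow> sym_psd (T ** W ** T)"
  using sym_psd_congruence[of W T] by (simp add: symmetric_mat_def)

text \<open>The form \<open>s \<mapsto> (x + s W x) \<bullet> W (x + s W x)\<close> vanishes at \<open>s = 0\<close> and is nonnegative, so its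
  derivative there, \<open>2 \<bar>W x\<bar>\<^sup>2\<close>, must vanish.\<close>

lemma sym_psd_kernel:
  assumes W: "sym_psd W" and 0: "x \<bullet> (W *v x) = 0"
  shows "W *v x = 0"
proof -
  define n c where "n = (W *v x) \<bullet> (W *v x)" and "c = (W *v x) \<bullet> (W *v (W *v x))"
  have c: "c \<ge> 0" using W by (simp add: sym_psd_def c_def)
  \<comment> \<open>The value at \<open>s\<close> is \<open>2 s n + s\<^sup>2 c\<close>, minimal at \<open>- n / c\<close>; the denominator \<open>c + 1\<close> is never zero.\<close>
  define s where "s = - n / (c + 1)"
  have "x \<bullet> (W *v (W *v x)) = n"
    using W by (simp add: n_def sym_psd_def symmetric_mat_iff_form)
  then have "(x + s *\<^sub>R (W *v x)) \<bullet> (W *v (x + s *\<^sub>R (W *v x))) = 2 * s * n + s\<^sup>2 * c"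
    using 0 by (simp add: form_simps matrix_vector_mult_scaleR n_def c_def power2_eq_square algebra_simps)
  moreover have "0 \<le> (x + s *\<^sub>R (W *v x)) \<bullet> (W *v (x + s *\<^sub>R (W *v x)))"
    using W by (simp add: sym_psd_def)
  moreover have "s * (c + 1) = - n" using c by (simp add: s_def)
  then have "(c + 1)\<^sup>2 * (2 * s * n + s\<^sup>2 * c) = - (n\<^sup>2 * (c + 2))" by algebra
  ultimately have "n\<^sup>2 * (c + 2) \<le> 0"
    by (metis neg_le_0_iff_le zero_le_mult_iff zero_le_power2 neg_0_le_iff_le)
  then have "n = 0" using c by (simp add: mult_le_0_iff)
  then show ?thesis by (simp add: n_def)
qed

section \<open>Stability in terms of real vectors\<close>

text \<open>A complex eigenvector \<open>a + i b\<close> of a real matrix is split into its real and imaginary part,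
  so that quadratic forms of real matrices can be evaluated on it.\<close>

lemma eigenvalue_complex_mat_iff:
  "eigenvalue (complex_mat M) z \<longleftrightarrow>
    (\<exists>a b. (a \<noteq> 0 \<or> b \<noteq> 0) \<and> M *v a = Re z *\<^sub>R a - Im z *\<^sub>R b \<and> M *v b = Im z *\<^sub>R a + Re z *\<^sub>R b)"
proof -
  have key: "complex_mat M *v v = z *s v \<longleftrightarrow>
      M *v (\<chi> i. Re (v $ i)) = Re z *\<^sub>R (\<chi> i. Re (v $ i)) - Im z *\<^sub>R (\<chi> i. Im (v $ i)) \<and>
      M *v (\<chi> i. Im (v $ i)) = Im z *\<^sub>R (\<chi> i. Re (v $ i)) + Re z *\<^sub>R (\<chi> i. Im (v $ i))" for v
    by (auto simp: vec_eq_iff complex_eq_iff matrix_vector_mult_def add.commute)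
  show ?thesis
  proof
    assume "eigenvalue (complex_mat M) z"
    then obtain v where v: "v \<noteq> 0" "complex_mat M *v v = z *s v"
      by (auto simp: eigenvalue_def)
    then have "(\<chi> i. Re (v $ i)) \<noteq> 0 \<or> (\<chi> i. Im (v $ i)) \<noteq> 0"
      by (auto simp: vec_eq_iff complex_eq_iff)
    with v(2) show "\<exists>a b. (a \<noteq> 0 \<or> b \<noteq> 0) \<and> M *v a = Re z *\<^sub>R a - Im z *\<^sub>R b \<and>
        M *v b = Im z *\<^sub>R a + Re z *\<^sub>R b"
      unfolding key by blast
  next
    assume "\<exists>a b. (a \<noteq> 0 \<or> b \<noteq> 0) \<and> M *v a = Re z *\<^sub>R a - Im z *\<^sub>R b \<and>
        M *v b = Im z *\<^sub>R a + Re z *\<^sub>R b"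
    then obtain a b where ab: "a \<noteq> 0 \<or> b \<noteq> 0" "M *v a = Re z *\<^sub>R a - Im z *\<^sub>R b"
      "M *v b = Im z *\<^sub>R a + Re z *\<^sub>R b" by blast
    let ?v = "\<chi> i. Complex (a $ i) (b $ i)"
    have "?v \<noteq> 0" using ab(1) by (auto simp: vec_eq_iff complex_eq_iff)
    moreover have "complex_mat M *v ?v = z *s ?v"
      using ab(2,3) unfolding key by simp
    ultimately show "eigenvalue (complex_mat M) z"
      by (auto simp: eigenvalue_def)
  qed
qed

lemma stable_iff_real:
  "stable M \<longleftrightarrow> (\<forall>\<alpha> \<beta> a b. (a \<noteq> 0 \<or> b \<noteq> 0) \<longrightarrow> M *v a = \<alpha> *\<^sub>R a - \<beta> *\<^sub>R b \<longrightarrow>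
     M *v b = \<beta> *\<^sub>R a + \<alpha> *\<^sub>R b \<longrightarrow> \<alpha> < 0)"
  (is "_ \<longleftrightarrow> ?R")
proof
  assume st: "stable M"
  show ?R
  proof (intro allI impI)
    fix \<alpha> \<beta> a b
    assume *: "a \<noteq> 0 \<or> b \<noteq> 0" "M *v a = \<alpha> *\<^sub>R a - \<beta> *\<^sub>R b" "M *v b = \<beta> *\<^sub>R a + \<alpha> *\<^sub>R b"
    have "eigenvalue (complex_mat M) (Complex \<alpha> \<beta>)"
      unfolding eigenvalue_complex_mat_iff using * by (intro exI[of _ a] exI[of _ b]) simp
    with st show "\<alpha> < 0" by (force simp: stable_def)
  qed
next
  assume R: ?R
  show "stable M"
    unfolding stable_def eigenvalue_complex_mat_iff using R by blast
qed

lemma eigenvalue_iff_det: "eigenvalue M z \<longleftrightarrow> det (M - mat z) = 0"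
proof -
  have "mat z *v v = z *s v" for v :: "complex ^ 'n"
    by (simp add: vec_eq_iff matrix_vector_mult_def mat_def mult_delta_left)
  then have m: "(M - mat z) *v v = M *v v - z *s v" for v
    by (simp add: matrix_vector_mult_diff_rdistrib)
  have "eigenvalue M z \<longleftrightarrow> (\<exists>v. v \<noteq> 0 \<and> (M - mat z) *v v = 0)"
    by (simp add: eigenvalue_def m)
  also have "\<dots> \<longleftrightarrow> \<not> invertible (M - mat z)"
    by (auto simp: invertible_left_inverse matrix_left_invertible_ker)
  finally show ?thesis by (simp add: invertible_det_nz)
qed

text \<open>Stability depends only on the characteristic polynomial, which is invariant under
  transposition.\<close>

lemma stable_transpose: "stable (transpose M) \<longleftrightarrow> stable M"
proof -
  have "det (complex_mat (transpose M) - mat z) = det (complex_mat M - mat z)" for z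
    by (subst det_transpose[symmetric], rule arg_cong[where f=det])
      (auto simp: vec_eq_iff transpose_def mat_def)
  then show ?thesis by (simp add: stable_def eigenvalue_iff_det)
qed

section \<open>Powers of a matrix with spectrum in the unit disc\<close>

text \<open>A sequence that contracts up to a vanishing error converges to zero. This removes one linear
  factor of an annihilating polynomial at a time.\<close>

lemma geometric_perturbation_tendsto_0:
  fixes u :: "nat \<Rightarrow> complex"
  assumes z: "cmod z < 1" and lim: "(\<lambda>k. u (Suc k) - z * u k) \<longlonglongrightarrow> 0"
  shows "u \<longlonglongrightarrow> 0"
proof (rule LIMSEQ_I)
  fix e :: real assume e: "0 < e"
  \<comment> \<open>An error below \<open>d\<close> in every step accumulates to at most \<open>d / (1 - \<bar>z\<bar>) = e / 2\<close>.\<close>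
  define d where "d = e * (1 - cmod z) / 2"
  have "d > 0" using e z by (simp add: d_def)
  then obtain N where N: "\<And>k. k \<ge> N \<Longrightarrow> cmod (u (Suc k) - z * u k) < d"
    using LIMSEQ_D[OF lim] by auto
  have bound: "cmod (u (N + j)) \<le> cmod z ^ j * cmod (u N) + e / 2" for j
  proof (induction j)
    case 0 then show ?case using e by simp
  next
    case (Suc j)
    have "cmod (u (N + Suc j)) \<le> cmod (z * u (N + j)) + cmod (u (Suc (N + j)) - z * u (N + j))"
      using norm_triangle_ineq[of "z * u (N + j)" "u (Suc (N + j)) - z * u (N + j)"] by simp
    also have "\<dots> \<le> cmod z * (cmod z ^ j * cmod (u N) + e / 2) + d"
      using Suc N[of "N + j"] by (intro add_mono) (auto simp: norm_mult intro: mult_left_mono)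
    also have "\<dots> = cmod z ^ Suc j * cmod (u N) + e / 2"
      by (simp add: d_def field_simps)
    finally show ?case .
  qed
  have "(\<lambda>j. cmod z ^ j * cmod (u N)) \<longlonglongrightarrow> 0"
    using z by (intro tendsto_mult_left_zero LIMSEQ_power_zero) auto
  then obtain J where J: "\<And>j. j \<ge> J \<Longrightarrow> cmod z ^ j * cmod (u N) < e / 2"
    using LIMSEQ_D[of _ 0 "e/2"] e by (fastforce simp: norm_mult norm_power)
  show "\<exists>n0. \<forall>n\<ge>n0. norm (u n - 0) < e"
  proof (intro exI[of _ "N + J"] allI impI)
    fix n assume "n \<ge> N + J"
    then have "J \<le> n - N" "N + (n - N) = n" by auto
    then show "norm (u n - 0) < e"
      using bound[of "n - N"] J[of "n - N"] by simp
  qed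
qed

text \<open>The vector \<open>p(M) v\<close>. Working on a fixed vector avoids a ring structure on square matrices.\<close>

definition poly_apply :: "complex ^ 'n ^ 'n \<Rightarrow> complex poly \<Rightarrow> complex ^ 'n \<Rightarrow> complex ^ 'n" where
  "poly_apply M p v = (\<Sum>i\<le>degree p. coeff p i *s (((*v) M ^^ i) v))"

lemma poly_apply_eq_sum:
  "degree p \<le> n \<Longrightarrow> poly_apply M p v = (\<Sum>i\<le>n. coeff p i *s (((*v) M ^^ i) v))"
  unfolding poly_apply_def
  by (rule sum.mono_neutral_left) (auto simp: coeff_eq_0)

lemma matrix_vector_mult_smult: "M *v (c *s v) = c *s (M *v v)" for M :: "complex ^ 'n ^ 'm"
  by (simp add: vec_eq_iff matrix_vector_mult_def sum_distrib_left mult_ac)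

lemma matrix_vector_mult_sum_right: "M *v (\<Sum>i\<in>I. f i) = (\<Sum>i\<in>I. M *v f i)"
  for M :: "complex ^ 'n ^ 'm"
  by (induction I rule: infinite_finite_induct) (simp_all add: matrix_vector_right_distrib)

lemma funpow_matrix_diff:
  "((*v) M ^^ i) (v - w) = ((*v) M ^^ i) v - ((*v) M ^^ i) w" for M :: "complex ^ 'n ^ 'n"
  by (induction i) (simp_all add: matrix_vector_mult_diff_distrib)

lemma funpow_matrix_smult:
  "((*v) M ^^ i) (c *s v) = c *s ((*v) M ^^ i) v" for M :: "complex ^ 'n ^ 'n"
  by (induction i) (simp_all add: matrix_vector_mult_smult)

lemma poly_apply_linear_factor:
  "poly_apply M ([:- z, 1:] * q) v = M *v poly_apply M q v - z *s poly_apply M q v" (is ?A)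
  "poly_apply M ([:- z, 1:] * q) v = poly_apply M q (M *v v - z *s v)" (is ?B)
proof -
  let ?n = "degree q" let ?w = "\<lambda>i. ((*v) M ^^ i) v"
  have deg: "degree ([:- z, 1:] * q) \<le> Suc ?n"
    using degree_mult_le[of "[:- z, 1:]" q] by simp
  have "poly_apply M ([:- z, 1:] * q) v = (\<Sum>i\<le>Suc ?n. coeff ([:- z, 1:] * q) i *s ?w i)"
    by (rule poly_apply_eq_sum[OF deg])
  also have "\<dots> = (\<Sum>i\<le>Suc ?n. coeff (pCons 0 q) i *s ?w i) - (\<Sum>i\<le>Suc ?n. (z * coeff q i) *s ?w i)"
    by (simp only: sum_subtractf[symmetric])
      (rule sum.cong, auto simp: vec_eq_iff algebra_simps)
  also have "(\<Sum>i\<le>Suc ?n. coeff (pCons 0 q) i *s ?w i) = (\<Sum>i\<le>?n. coeff q i *s ?w (Suc i))"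
    by (subst sum.atMost_Suc_shift) simp
  also have "\<dots> = M *v poly_apply M q v"
    by (simp add: poly_apply_def matrix_vector_mult_sum_right matrix_vector_mult_smult)
  also have "(\<Sum>i\<le>Suc ?n. (z * coeff q i) *s ?w i) = z *s poly_apply M q v"
    by (simp add: poly_apply_def coeff_eq_0 vec_eq_iff sum_distrib_left mult_ac)
  finally show A: ?A .
  have "poly_apply M q (M *v v - z *s v) = M *v poly_apply M q v - z *s poly_apply M q v"
    by (simp add: poly_apply_def funpow_matrix_diff funpow_matrix_smult funpow_swap1
        matrix_vector_mult_sum_right matrix_vector_mult_smult)
      (simp add: vec_eq_iff sum_subtractf sum_distrib_left algebra_simps)
  with A show ?B by simp
qed

text \<open>The first \<open>dim + 1\<close> elements of the orbit of \<open>v\<close> are linearly dependent over the reals; if two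
  of them coincide, the difference of two monomials already works.\<close>

lemma ex_annihilating_poly:
  fixes M :: "complex ^ 'n ^ 'n"
  shows "\<exists>p. p \<noteq> 0 \<and> poly_apply M p v = 0"
proof (cases "inj_on (\<lambda>i. ((*v) M ^^ i) v) {..DIM(complex ^ 'n)}")
  case False
  then obtain i j where ij: "i < j" "((*v) M ^^ i) v = ((*v) M ^^ j) v"
    by (auto simp: inj_on_def) (metis linorder_neqE_nat)
  let ?p = "monom 1 j - monom 1 i :: complex poly"
  have "degree ?p \<le> j"
    using ij(1) by (intro degree_diff_le) (auto intro: order.trans[OF degree_monom_le])
  then have "poly_apply M ?p v = (\<Sum>k\<le>j. coeff ?p k *s (((*v) M ^^ k) v))"
    by (rule poly_apply_eq_sum)
  also have "\<dots> = (\<Sum>k\<le>j. (if k = j then ((*v) M ^^ j) v else 0) - (if k = i then ((*v) M ^^ i) v else 0))"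
    by (rule sum.cong) (auto simp: vec_eq_iff)
  also have "\<dots> = 0" using ij by (simp add: sum_subtractf)
  finally have "poly_apply M ?p v = 0" .
  moreover have "coeff ?p j = 1" using ij(1) by simp
  then have "?p \<noteq> 0" by (metis coeff_0 zero_neq_one)
  ultimately show ?thesis by blast
next
  case True
  let ?w = "\<lambda>i. ((*v) M ^^ i) v" and ?n = "DIM(complex ^ 'n)"
  have "card (?w ` {..?n}) = Suc ?n" using True by (simp add: card_image)
  then have "dependent (?w ` {..?n})" by (intro dependent_biggerset) simp
  then obtain c where c: "\<exists>x\<in>?w ` {..?n}. c x \<noteq> 0" "(\<Sum>x\<in>?w ` {..?n}. c x *\<^sub>R x) = 0"
    by (auto simp: dependent_finite)
  define p where "p = (\<Sum>i\<le>?n. monom (complex_of_real (c (?w i))) i)"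
  have co: "coeff p i = (if i \<le> ?n then of_real (c (?w i)) else 0)" for i
    by (auto simp: p_def coeff_sum)
  have "degree p \<le> ?n" by (intro degree_le) (auto simp: co)
  then have "poly_apply M p v = (\<Sum>i\<le>?n. coeff p i *s ?w i)" by (rule poly_apply_eq_sum)
  also have "\<dots> = (\<Sum>i\<le>?n. c (?w i) *\<^sub>R ?w i)"
    by (rule sum.cong) (auto simp: co vec_eq_iff complex_eq_iff)
  also have "\<dots> = 0" using c(2) True by (simp add: sum.reindex)
  finally have "poly_apply M p v = 0" .
  moreover have "p \<noteq> 0" using c(1) co by (auto simp: poly_eq_iff)
  ultimately show ?thesis by blast
qed

text \<open>Induction on the degree of a polynomial \<open>p\<close> with \<open>p(M) v = 0\<close>. Split off a root \<open>z\<close> of \<open>p\<close>.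
  If \<open>z\<close> lies in the unit disc, the induction hypothesis applied to \<open>M v - z v\<close> says that the orbit
  of \<open>v\<close> contracts up to a vanishing error. Otherwise \<open>z\<close> is not an eigenvalue, so the factor
  \<open>M - z\<close> can be cancelled and the cofactor of \<open>p\<close> already annihilates \<open>v\<close>.\<close>

lemma funpow_matrix_tendsto_0_complex:
  fixes M :: "complex ^ 'n ^ 'n"
  assumes spec: "\<And>z. eigenvalue M z \<Longrightarrow> cmod z < 1"
  shows "(\<lambda>k. ((*v) M ^^ k) v) \<longlonglongrightarrow> 0"
proof -
  have "p \<noteq> 0 \<Longrightarrow> poly_apply M p v = 0 \<Longrightarrow> (\<lambda>k. ((*v) M ^^ k) v) \<longlonglongrightarrow> 0" for p v
  proof (induction "degree p" arbitrary: p v)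
    case 0
    then obtain c where "p = [:c:]" by (metis degree_eq_zeroE)
    with 0 have "v = 0" by (auto simp: poly_apply_def)
    moreover have "((*v) M ^^ k) 0 = 0" for k by (induction k) auto
    ultimately show ?case by simp
  next
    case (Suc n)
    then obtain z where "poly p z = 0"
      using fundamental_theorem_of_algebra[of p] by (auto simp: constant_degree)
    then obtain q where p: "p = [:- z, 1:] * q" by (metis poly_eq_0_iff_dvd dvdE)
    with Suc.prems have q: "q \<noteq> 0" by auto
    have "degree p = Suc (degree q)"
      unfolding p by (subst degree_mult_eq) (use q in auto)
    with Suc.hyps(2) have deg: "n = degree q" by simp
    show ?case
    proof (cases "cmod z < 1")
      case True
      have "poly_apply M q (M *v v - z *s v) = 0"
        using Suc.prems(2) p poly_apply_linear_factor(2) by metis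
      then have "(\<lambda>k. ((*v) M ^^ k) (M *v v - z *s v)) \<longlonglongrightarrow> 0"
        using Suc.hyps(1) deg q by blast
      then have "(\<lambda>k. ((*v) M ^^ k) (M *v v - z *s v) $ i) \<longlonglongrightarrow> 0 $ i" for i
        by (rule tendsto_vec_nth)
      then have "(\<lambda>k. (((*v) M ^^ Suc k) v) $ i - z * ((((*v) M ^^ k) v) $ i)) \<longlonglongrightarrow> 0" for i
        by (simp add: funpow_matrix_diff funpow_matrix_smult funpow_swap1)
      then have "(\<lambda>k. (((*v) M ^^ k) v) $ i) \<longlonglongrightarrow> 0" for i
        by (rule geometric_perturbation_tendsto_0[OF True])
      then show ?thesis by (intro vec_tendstoI) simp
    next
      case False
      then have "\<not> eigenvalue M z" using spec by blast
      moreover have "M *v poly_apply M q v = z *s poly_apply M q v"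
        using Suc.prems(2) p poly_apply_linear_factor(1) by (metis eq_iff_diff_eq_0)
      ultimately have "poly_apply M q v = 0" by (auto simp: eigenvalue_def)
      then show ?thesis using Suc.hyps(1) deg q by blast
    qed
  qed
  then show ?thesis using ex_annihilating_poly by blast
qed

lemma funpow_matrix_tendsto_0:
  fixes M :: "real ^ 'n ^ 'n"
  assumes spec: "\<And>z. eigenvalue (complex_mat M) z \<Longrightarrow> cmod z < 1"
  shows "(\<lambda>k. ((*v) M ^^ k) x) \<longlonglongrightarrow> 0"
proof -
  let ?c = "\<lambda>x :: real ^ 'n. \<chi> i. complex_of_real (x $ i)"
  have "((*v) (complex_mat M) ^^ k) (?c x) = ?c (((*v) M ^^ k) x)" for k
    by (induction k) (simp_all add: vec_eq_iff matrix_vector_mult_def)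
  then have "(\<lambda>k. ?c (((*v) M ^^ k) x)) \<longlonglongrightarrow> 0"
    using funpow_matrix_tendsto_0_complex[OF spec, of "complex_mat M" "?c x"] by simp
  then have "(\<lambda>k. ?c (((*v) M ^^ k) x) $ i) \<longlonglongrightarrow> 0 $ i" for i
    by (rule tendsto_vec_nth)
  then have "(\<lambda>k. Re (?c (((*v) M ^^ k) x) $ i)) \<longlonglongrightarrow> Re (0 $ i)" for i
    by (rule tendsto_Re)
  then show ?thesis
    by (intro vec_tendstoI) simp
qed

section \<open>Lyapunov equations\<close>

lemma lyapunov_eq_iff_form:
  "lyapunov_eq M W X \<longleftrightarrow>
     (\<forall>x y. (M *v x) \<bullet> (X *v y) + x \<bullet> (X *v (M *v y)) = - (x \<bullet> (W *v y)))"
  by (simp add: lyapunov_eq_def matrix_eq_iff_form form_simps)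

lemma lyapunov_eq_diff:
  "lyapunov_eq M (W + E) X \<Longrightarrow> lyapunov_eq M W Y \<Longrightarrow> lyapunov_eq M E (X - Y)"
  by (simp add: lyapunov_eq_iff_form form_simps algebra_simps)

text \<open>The Cayley transform \<open>S = (I + M) (I - M)\<^sup>-\<^sup>1\<close> maps the left half plane to the unit disc; it is a
  discrete substitute for the flow \<open>exp (t M)\<close>. The matrix \<open>N\<close> is \<open>(I - M)\<^sup>-\<^sup>1\<close>.\<close>

lemma cayley_transform:
  fixes M :: "real ^ 'n ^ 'n"
  assumes st: "stable M"
  obtains S N :: "real ^ 'n ^ 'n" where
    "\<And>x. (\<lambda>k. ((*v) S ^^ k) x) \<longlonglongrightarrow> 0"
    "\<And>x. N *v x - M *v (N *v x) = x"
    "\<And>x. S *v x = N *v x + M *v (N *v x)"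
proof -
  have "x = 0" if "(mat 1 - M) *v x = 0" for x
  proof (rule ccontr)
    assume "x \<noteq> 0"
    with that show False
      using st[unfolded stable_iff_real, rule_format, of x 0 1 0]
      by (simp add: matrix_vector_mult_diff_rdistrib)
  qed
  then have "invertible (mat 1 - M)"
    by (simp add: invertible_left_inverse matrix_left_invertible_ker)
  then obtain N where N: "(mat 1 - M) ** N = mat 1" by (auto simp: invertible_def)
  define S where "S = (mat 1 + M) ** N"
  have 1: "N *v x - M *v (N *v x) = x" for x
  proof -
    have "(mat 1 - M) *v (N *v x) = x" by (simp add: matrix_vector_mul_assoc N)
    then show ?thesis by (simp add: matrix_vector_mult_diff_rdistrib)
  qed
  have 2: "S *v x = N *v x + M *v (N *v x)" for x
    by (simp add: S_def form_simps)
  have "cmod z < 1" if "eigenvalue (complex_mat S) z" for z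
  proof -
    define p q where "p = Re z" and "q = Im z"
    define D where "D = (1 + p)\<^sup>2 + q\<^sup>2"
    from that obtain a b where ab: "a \<noteq> 0 \<or> b \<noteq> 0"
      "S *v a = p *\<^sub>R a - q *\<^sub>R b" "S *v b = q *\<^sub>R a + p *\<^sub>R b"
      by (auto simp: eigenvalue_complex_mat_iff p_def q_def)
    \<comment> \<open>If \<open>S x = z x\<close> then \<open>N x\<close> is an eigenvector of \<open>M\<close> for \<open>(z - 1) / (z + 1)\<close>, whose real
      part is \<open>(\<bar>z\<bar>\<^sup>2 - 1) / \<bar>z + 1\<bar>\<^sup>2\<close>, that is, \<open>r / D\<close> in the notation below.\<close>
    define u w where "u = N *v a" and "w = N *v b"
    have a: "a = u - M *v u" and b: "b = w - M *v w" using 1 by (auto simp: u_def w_def)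
    have "u + M *v u = p *\<^sub>R (u - M *v u) - q *\<^sub>R (w - M *v w)"
      "w + M *v w = q *\<^sub>R (u - M *v u) + p *\<^sub>R (w - M *v w)"
      using ab(2,3) 2 a b unfolding u_def w_def by metis+
    then have e: "u $ i + (M *v u) $ i = p * (u $ i - (M *v u) $ i) - q * (w $ i - (M *v w) $ i)"
      "w $ i + (M *v w) $ i = q * (u $ i - (M *v u) $ i) + p * (w $ i - (M *v w) $ i)" for i
      by (auto simp: vec_eq_iff)
    have e1: "D * (M *v u) $ i = (p\<^sup>2 + q\<^sup>2 - 1) * u $ i - 2 * q * w $ i" for i
      using e[of i] unfolding D_def by algebra
    have e2: "D * (M *v w) $ i = 2 * q * u $ i + (p\<^sup>2 + q\<^sup>2 - 1) * w $ i" for i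
      using e[of i] unfolding D_def by algebra
    have uw: "u \<noteq> 0 \<or> w \<noteq> 0" using ab(1) a b by auto
    have "D \<noteq> 0"
    proof
      assume "D = 0"
      then have "1 + p = 0" "q = 0" by (auto simp: D_def sum_power2_eq_zero_iff)
      then have "p = -1" "q = 0" by auto
      with e have "u $ i = 0 \<and> w $ i = 0" for i
        using e[of i] by simp
      with uw show False by (auto simp: vec_eq_iff)
    qed
    then have "D > 0" unfolding D_def by (metis sum_power2_gt_zero_iff sum_power2_eq_zero_iff)
    define r where "r = p\<^sup>2 + q\<^sup>2 - 1"
    have "(M *v u) $ i = (r * u $ i - 2 * q * w $ i) / D"
      "(M *v w) $ i = (2 * q * u $ i + r * w $ i) / D" for i
      unfolding r_def using e1[of i] e2[of i] \<open>D \<noteq> 0\<close> by (simp_all add: nonzero_eq_divide_eq mult.commute)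
    then have "M *v u = (r / D) *\<^sub>R u - (2 * q / D) *\<^sub>R w"
      "M *v w = (2 * q / D) *\<^sub>R u + (r / D) *\<^sub>R w"
      by (simp_all add: vec_eq_iff add_divide_distrib diff_divide_distrib)
    then have "r / D < 0"
      using st uw unfolding stable_iff_real by blast
    with \<open>D > 0\<close> have "p\<^sup>2 + q\<^sup>2 < 1" by (simp add: divide_less_0_iff r_def)
    then show "cmod z < 1" by (simp add: cmod_def p_def q_def)
  qed
  then show ?thesis using that[OF funpow_matrix_tendsto_0 1 2] by blast
qed

text \<open>Under the Cayley transform the Lyapunov equation becomes the Stein equation
  \<open>X = S\<^sup>T X S + 2 N\<^sup>T W N\<close>, which says how the form of \<open>X\<close> changes along an orbit of \<open>S\<close>.\<close>

lemma lyapunov_eq_cayley: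
  assumes "lyapunov_eq M W X"
    and "\<And>x. N *v x - M *v (N *v x) = x" "\<And>x. S *v x = N *v x + M *v (N *v x)"
  shows "x \<bullet> (X *v y) = (S *v x) \<bullet> (X *v (S *v y)) + 2 * ((N *v x) \<bullet> (W *v (N *v y)))"
proof -
  define a b where "a = N *v x" and "b = N *v y"
  have eqs: "x = a - M *v a" "y = b - M *v b" "S *v x = a + M *v a" "S *v y = b + M *v b"
    using assms(2,3) by (simp_all add: a_def b_def)
  have "(M *v a) \<bullet> (X *v b) + a \<bullet> (X *v (M *v b)) = - (a \<bullet> (W *v b))"
    using assms(1) by (simp add: lyapunov_eq_iff_form)
  then have "(a - M *v a) \<bullet> (X *v (b - M *v b)) =
      (a + M *v a) \<bullet> (X *v (b + M *v b)) + 2 * (a \<bullet> (W *v b))"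
    by (simp add: form_simps)
  then show ?thesis using eqs by (metis a_def b_def)
qed

text \<open>The form of the difference of two solutions is constant along orbits of the Cayley transform,
  and these converge to zero.\<close>

lemma lyapunov_unique:
  assumes st: "stable M" and X: "lyapunov_eq M W X" and Y: "lyapunov_eq M W Y"
  shows "X = Y"
proof -
  obtain S N where lim: "\<And>x. (\<lambda>k. ((*v) S ^^ k) x) \<longlonglongrightarrow> 0"
    and N: "\<And>x. N *v x - M *v (N *v x) = x" and S: "\<And>x. S *v x = N *v x + M *v (N *v x)"
    using cayley_transform[OF st] by blast
  let ?Z = "X - Y"
  have "lyapunov_eq M 0 ?Z"
    using X Y by (simp add: lyapunov_eq_iff_form form_simps algebra_simps)
  note step = lyapunov_eq_cayley[OF this N S]
  have const: "(((*v) S ^^ k) x) \<bullet> (?Z *v (((*v) S ^^ k) y)) = x \<bullet> (?Z *v y)" for k x y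
  proof (induction k)
    case (Suc k)
    then show ?case using step[of "((*v) S ^^ k) x" "((*v) S ^^ k) y"] by simp
  qed simp
  have "x \<bullet> (?Z *v y) = 0" for x y
  proof -
    have "(\<lambda>k. (((*v) S ^^ k) x) \<bullet> (?Z *v (((*v) S ^^ k) y))) \<longlonglongrightarrow> 0 \<bullet> (?Z *v 0)"
      by (intro tendsto_inner lim bounded_linear.tendsto[OF matrix_vector_mul_bounded_linear])
    then show ?thesis unfolding const by (simp add: LIMSEQ_const_iff)
  qed
  then have "?Z = 0" by (simp add: matrix_eq_iff_form)
  then show ?thesis by simp
qed

text \<open>In finite dimension the injectivity of the Lyapunov operator gives its surjectivity.\<close>

lemma lyapunov_ex1:
  assumes st: "stable M"
  shows "\<exists>!X. lyapunov_eq M W X"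
proof -
  let ?L = "\<lambda>X. transpose M ** X + X ** M"
  have lin: "linear ?L"
    by (rule linearI) (simp_all add: matrix_eq_iff_form form_simps scaleR_matrix_vector_assoc[symmetric]
      matrix_vector_mult_scaleR scaleR_right_distrib algebra_simps)
  have "inj ?L"
  proof (rule injI)
    fix X Y assume "?L X = ?L Y"
    then have "lyapunov_eq M (- ?L Y) X" "lyapunov_eq M (- ?L Y) Y"
      by (auto simp: lyapunov_eq_def)
    then show "X = Y" by (rule lyapunov_unique[OF st])
  qed
  with lin have "surj ?L" by (intro linear_injective_imp_surjective) auto
  then obtain X where "- W = ?L X" by (rule surjE)
  then have "lyapunov_eq M W X" by (simp add: lyapunov_eq_def)
  then show ?thesis using lyapunov_unique[OF st] by blast
qed

lemma lyapunov_sol_eq: "stable M \<Longrightarrow> lyapunov_eq M W (lyapunov_sol M W)"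
  unfolding lyapunov_sol_def by (rule theI') (rule lyapunov_ex1)

text \<open>The transpose of \<open>X\<close> solves the same equation, hence \<open>X\<close> is symmetric. Its quadratic form
  decreases to zero along every orbit of the Cayley transform, hence it was nonnegative.\<close>

lemma lyapunov_sym_psd:
  assumes st: "stable M" and eq: "lyapunov_eq M W X" and W: "sym_psd W"
  shows "sym_psd X"
proof -
  obtain S N where lim: "\<And>x. (\<lambda>k. ((*v) S ^^ k) x) \<longlonglongrightarrow> 0"
    and N: "\<And>x. N *v x - M *v (N *v x) = x" and S: "\<And>x. S *v x = N *v x + M *v (N *v x)"
    using cayley_transform[OF st] by blast
  have "lyapunov_eq M W (transpose X)"
    unfolding lyapunov_eq_iff_form
  proof (intro allI)
    fix x y
    have "(M *v y) \<bullet> (X *v x) + y \<bullet> (X *v (M *v x)) = - (y \<bullet> (W *v x))"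
      using eq by (simp add: lyapunov_eq_iff_form)
    moreover have "y \<bullet> (W *v x) = x \<bullet> (W *v y)"
      using W by (metis sym_psd_def symmetric_mat_iff_form inner_commute)
    ultimately show "(M *v x) \<bullet> (transpose X *v y) + x \<bullet> (transpose X *v (M *v y)) = - (x \<bullet> (W *v y))"
      by (simp add: inner_transpose inner_commute add.commute)
  qed
  then have sym: "symmetric_mat X"
    unfolding symmetric_mat_def using lyapunov_unique[OF st _ eq] by blast
  have "0 \<le> x \<bullet> (X *v x)" for x
  proof -
    let ?q = "\<lambda>k. (((*v) S ^^ k) x) \<bullet> (X *v (((*v) S ^^ k) x))"
    have "decseq ?q"
      unfolding decseq_Suc_iff
    proof
      fix k
      have "0 \<le> (N *v y) \<bullet> (W *v (N *v y))" for y using W by (simp add: sym_psd_def)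
      then show "?q (Suc k) \<le> ?q k"
        using lyapunov_eq_cayley[OF eq N S, of "((*v) S ^^ k) x" "((*v) S ^^ k) x"] by simp
    qed
    moreover have "?q \<longlonglongrightarrow> 0 \<bullet> (X *v 0)"
      by (intro tendsto_inner lim bounded_linear.tendsto[OF matrix_vector_mul_bounded_linear])
    ultimately have "0 \<bullet> (X *v 0) \<le> ?q 0" by (rule decseq_ge)
    then show ?thesis by simp
  qed
  with sym show ?thesis by (simp add: sym_psd_def)
qed

text \<open>The single criterion behind all stability claims of this development. If \<open>M'\<close> had an eigenvalue
  with nonnegative real part, the Lyapunov equation would force the form of \<open>W\<close> to vanish on the
  real and imaginary part of the eigenvector; there \<open>M'\<close> agrees with \<open>M\<close>, so \<open>M\<close> would have the same
  eigenvalue. For positive definite \<open>W\<close> this is Lyapunov's theorem; for semidefinite \<open>W\<close> it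
  replaces the Hautus test.\<close>

lemma stable_transfer:
  assumes M: "stable M" and X: "sym_psd X" and eq: "lyapunov_eq M' W X"
    and W: "\<And>x. 0 \<le> x \<bullet> (W *v x)" and agree: "\<And>x. x \<bullet> (W *v x) = 0 \<Longrightarrow> M' *v x = M *v x"
  shows "stable M'"
  unfolding stable_iff_real
proof (intro allI impI, rule ccontr)
  fix \<alpha> \<beta> a b
  assume ab: "a \<noteq> 0 \<or> b \<noteq> 0" and a: "M' *v a = \<alpha> *\<^sub>R a - \<beta> *\<^sub>R b"
    and b: "M' *v b = \<beta> *\<^sub>R a + \<alpha> *\<^sub>R b" and \<alpha>: "\<not> \<alpha> < 0"
  have sym: "b \<bullet> (X *v a) = a \<bullet> (X *v b)"
    using X by (metis sym_psd_def symmetric_mat_iff_form inner_commute)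
  have "(M' *v a) \<bullet> (X *v a) + a \<bullet> (X *v (M' *v a)) = - (a \<bullet> (W *v a))"
    "(M' *v b) \<bullet> (X *v b) + b \<bullet> (X *v (M' *v b)) = - (b \<bullet> (W *v b))"
    using eq by (simp_all add: lyapunov_eq_iff_form)
  then have "2 * \<alpha> * (a \<bullet> (X *v a) + b \<bullet> (X *v b)) = - (a \<bullet> (W *v a) + b \<bullet> (W *v b))"
    unfolding a b
    by (simp add: form_simps matrix_vector_mult_scaleR sym) (simp add: algebra_simps)
  moreover have "0 \<le> 2 * \<alpha> * (a \<bullet> (X *v a) + b \<bullet> (X *v b))"
    using \<alpha> X by (intro mult_nonneg_nonneg add_nonneg_nonneg) (auto simp: sym_psd_def)
  ultimately have "a \<bullet> (W *v a) = 0" "b \<bullet> (W *v b) = 0" using W[of a] W[of b] by auto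
  then have "M *v a = \<alpha> *\<^sub>R a - \<beta> *\<^sub>R b" "M *v b = \<beta> *\<^sub>R a + \<alpha> *\<^sub>R b"
    using agree a b by metis+
  with M ab have "\<alpha> < 0" unfolding stable_iff_real by blast
  with \<alpha> show False by simp
qed

section \<open>The Newton--Kleinman iteration\<close>

text \<open>The quadratic forms converge as bounded monotone real sequences, and polarization recovers the
  matrix entries from them.\<close>

lemma sym_psd_mono_convergent:
  fixes P :: "nat \<Rightarrow> real ^ 'n ^ 'n"
  assumes psd: "\<And>k. sym_psd (P k)" and dec: "\<And>k. sym_psd (P k - P (Suc k))"
  shows "\<exists>L. sym_psd L \<and> P \<longlonglongrightarrow> L"
proof -
  have "\<exists>l. (\<lambda>k. x \<bullet> (P k *v x)) \<longlonglongrightarrow> l" for x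
  proof -
    have "x \<bullet> (P (Suc k) *v x) \<le> x \<bullet> (P k *v x)" for k
      using dec[of k] by (simp add: sym_psd_def matrix_vector_mult_diff_rdistrib inner_diff_right)
    then have dec_form: "decseq (\<lambda>k. x \<bullet> (P k *v x))" by (simp add: decseq_Suc_iff)
    have "0 \<le> x \<bullet> (P k *v x)" for k using psd by (simp add: sym_psd_def)
    then show ?thesis using decseq_convergent[OF dec_form, of 0] by blast
  qed
  then have "\<exists>q. \<forall>x. (\<lambda>k. x \<bullet> (P k *v x)) \<longlonglongrightarrow> q x" by (intro choice allI)
  then obtain q where q: "\<And>x. (\<lambda>k. x \<bullet> (P k *v x)) \<longlonglongrightarrow> q x" by blast
  have form_lim: "(\<lambda>k. x \<bullet> (P k *v y)) \<longlonglongrightarrow> (q (x + y) - q x - q y) / 2" for x y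
  proof -
    have "x \<bullet> (P k *v y) = ((x + y) \<bullet> (P k *v (x + y)) - x \<bullet> (P k *v x) - y \<bullet> (P k *v y)) / 2" for k
    proof -
      have "y \<bullet> (P k *v x) = x \<bullet> (P k *v y)"
        using psd[of k] by (simp add: sym_psd_def symmetric_mat_iff_form inner_commute[of y "P k *v x"])
      then show ?thesis by (simp add: form_simps)
    qed
    then have "(\<lambda>k. x \<bullet> (P k *v y)) =
        (\<lambda>k. ((x + y) \<bullet> (P k *v (x + y)) - x \<bullet> (P k *v x) - y \<bullet> (P k *v y)) / 2)"
      by (rule ext)
    moreover have "\<dots> \<longlonglongrightarrow> (q (x + y) - q x - q y) / 2"
      by (intro tendsto_divide tendsto_diff tendsto_const q) simp
    ultimately show ?thesis by simp
  qed
  define l where "l i j = (q (axis i 1 + axis j 1) - q (axis i 1) - q (axis j 1)) / 2" for i j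
  have "axis i 1 \<bullet> (P k *v axis j 1) = P k $ i $ j" for i j k
    by (simp add: inner_axis' matrix_vector_mult_basis column_def)
  then have "(\<lambda>k. P k $ i $ j) \<longlonglongrightarrow> l i j" for i j
    using form_lim[of "axis i 1" "axis j 1"] by (simp add: l_def)
  then have lim: "P \<longlonglongrightarrow> (\<chi> i j. l i j)" by (intro vec_tendstoI) simp
  let ?L = "\<chi> i j. l i j"
  have vec: "(\<lambda>k. P k *v y) \<longlonglongrightarrow> ?L *v y" for y
  proof (rule vec_tendstoI)
    fix i
    have "(\<lambda>k. \<Sum>j\<in>UNIV. P k $ i $ j * y $ j) \<longlonglongrightarrow> (\<Sum>j\<in>UNIV. ?L $ i $ j * y $ j)"
      by (intro tendsto_intros tendsto_vec_nth lim)
    then show "(\<lambda>k. (P k *v y) $ i) \<longlonglongrightarrow> (?L *v y) $ i"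
      by (simp add: matrix_vector_mult_def)
  qed
  have form: "(\<lambda>k. x \<bullet> (P k *v y)) \<longlonglongrightarrow> x \<bullet> (?L *v y)" for x y
    by (intro tendsto_intros vec)
  have "(?L *v x) \<bullet> y = x \<bullet> (?L *v y)" for x y
  proof (rule LIMSEQ_unique)
    show "(\<lambda>k. (P k *v x) \<bullet> y) \<longlonglongrightarrow> (?L *v x) \<bullet> y"
      by (intro tendsto_intros vec)
    have "(P k *v x) \<bullet> y = x \<bullet> (P k *v y)" for k
      using psd by (simp add: sym_psd_def symmetric_mat_iff_form)
    then show "(\<lambda>k. (P k *v x) \<bullet> y) \<longlonglongrightarrow> x \<bullet> (?L *v y)"
      using form by simp
  qed
  moreover have "0 \<le> x \<bullet> (?L *v x)" for x
    by (rule LIMSEQ_le_const[OF form]) (use psd in \<open>auto simp: sym_psd_def\<close>)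
  ultimately have "sym_psd ?L" by (simp add: sym_psd_def symmetric_mat_iff_form)
  with lim show ?thesis by blast
qed

lemma tendsto_matrix_mult:
  fixes X :: "'c \<Rightarrow> real ^ 'n ^ 'm" and Y :: "'c \<Rightarrow> real ^ 'p ^ 'n"
  assumes "(X \<longlongrightarrow> L) \<F>" "(Y \<longlongrightarrow> K) \<F>"
  shows "((\<lambda>k. X k ** Y k) \<longlongrightarrow> L ** K) \<F>"
proof (intro vec_tendstoI)
  fix i j
  have "((\<lambda>k. \<Sum>l\<in>UNIV. X k $ i $ l * Y k $ l $ j) \<longlongrightarrow> (\<Sum>l\<in>UNIV. L $ i $ l * K $ l $ j)) \<F>"
    by (intro tendsto_intros tendsto_vec_nth assms)
  then show "((\<lambda>k. (X k ** Y k) $ i $ j) \<longlongrightarrow> (L ** K) $ i $ j) \<F>"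
    by (simp add: matrix_matrix_mult_def)
qed

text \<open>Here \<open>A - G\<close> is a closed loop given by any stabilizing feedback, \<open>S\<close> is the running cost of that
  feedback, and \<open>X\<close> its total cost. The matrix \<open>E\<close> is the square that completes
  \<open>S - G\<^sup>T X - X G + X F X\<close>: it measures how far the feedback is from the one that is greedy with
  respect to \<open>X\<close>. Where the form of \<open>E\<close> vanishes both feedbacks agree, so stability passes to the
  greedy closed loop.\<close>

lemma policy_improvement:
  assumes F: "sym_psd F" and Q: "sym_psd Q" and S: "sym_psd S" and E: "sym_psd E"
    and st: "stable (A - G)" and X: "lyapunov_eq (A - G) (Q + S) X"
    and E_form: "\<And>x y. x \<bullet> (E *v y) =
      x \<bullet> (S *v y) - (G *v x) \<bullet> (X *v y) - x \<bullet> (X *v (G *v y)) + x \<bullet> (X *v (F *v (X *v y)))"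
    and E_kernel: "\<And>x. x \<bullet> (E *v x) = 0 \<Longrightarrow> G *v x = F *v (X *v x)"
  shows "sym_psd X" "lyapunov_eq (A - F ** X) (X ** F ** X + Q + E) X" "stable (A - F ** X)"
proof -
  show psd: "sym_psd X"
    by (rule lyapunov_sym_psd[OF st X]) (intro sym_psd_add Q S)
  have "((A - G) *v x) \<bullet> (X *v y) + x \<bullet> (X *v ((A - G) *v y)) = - (x \<bullet> ((Q + S) *v y))" for x y
    using X by (simp add: lyapunov_eq_iff_form)
  then show eq: "lyapunov_eq (A - F ** X) (X ** F ** X + Q + E) X"
    unfolding lyapunov_eq_iff_form
    by (simp add: form_simps E_form sym_psd_symD[OF F] sym_psd_symD[OF psd] algebra_simps)
  have XFX: "sym_psd (X ** F ** X)"
    using F psd by (intro sym_psd_congruence_sym) (auto simp: sym_psd_def)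
  have W: "sym_psd (X ** F ** X + Q + E)" by (intro sym_psd_add XFX Q E)
  show "stable (A - F ** X)"
  proof (rule stable_transfer[OF st psd eq])
    show "0 \<le> x \<bullet> ((X ** F ** X + Q + E) *v x)" for x using sym_psd_nonneg[OF W] .
    fix x assume "x \<bullet> ((X ** F ** X + Q + E) *v x) = 0"
    then have "x \<bullet> (E *v x) = 0"
      using sym_psd_nonneg[OF XFX, of x] sym_psd_nonneg[OF Q, of x] sym_psd_nonneg[OF E, of x]
      by (simp add: matrix_vector_mult_add_rdistrib inner_add_right)
    from E_kernel[OF this] show "(A - F ** X) *v x = (A - G) *v x"
      by (simp add: matrix_vector_mult_diff_rdistrib matrix_vector_mul_assoc[symmetric])
  qed
qed

text \<open>Policy improvement for the feedback coming from \<open>P\<close>, with running cost \<open>P F P\<close>; the completed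
  square is \<open>(P - X) F (P - X)\<close>.\<close>

lemma newton_step:
  assumes F: "sym_psd F" and Q: "sym_psd Q" and P: "symmetric_mat P"
    and st: "stable (A - F ** P)" and X: "lyapunov_eq (A - F ** P) (P ** F ** P + Q) X"
  shows "sym_psd X"
    and "lyapunov_eq (A - F ** X) (X ** F ** X + Q + (P - X) ** F ** (P - X)) X"
    and "stable (A - F ** X)"
proof -
  have S: "sym_psd (P ** F ** P)" by (rule sym_psd_congruence_sym[OF F P])
  have X': "lyapunov_eq (A - F ** P) (Q + P ** F ** P) X" using X by (simp add: add.commute)
  have psd: "sym_psd X"
    by (rule lyapunov_sym_psd[OF st X]) (intro sym_psd_add Q S)
  have symP: "(P *v x) \<bullet> y = x \<bullet> (P *v y)" for x y using P by (simp add: symmetric_mat_iff_form)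
  have "symmetric_mat (P - X)"
    by (simp add: symmetric_mat_iff_form form_simps symP sym_psd_symD[OF psd])
  then have E: "sym_psd ((P - X) ** F ** (P - X))" by (rule sym_psd_congruence_sym[OF F])
  have form: "x \<bullet> (((P - X) ** F ** (P - X)) *v y) = x \<bullet> ((P ** F ** P) *v y) -
      ((F ** P) *v x) \<bullet> (X *v y) - x \<bullet> (X *v ((F ** P) *v y)) + x \<bullet> (X *v (F *v (X *v y)))" for x y
    by (simp add: form_simps sym_psd_symD[OF F] symP)
  have kernel: "(F ** P) *v x = F *v (X *v x)" if "x \<bullet> (((P - X) ** F ** (P - X)) *v x) = 0" for x
  proof -
    have "((P - X) *v x) \<bullet> (F *v ((P - X) *v x)) = 0"
      using that by (simp add: form_simps symP sym_psd_symD[OF psd])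
    then have "F *v ((P - X) *v x) = 0" by (rule sym_psd_kernel[OF F])
    then show ?thesis by (simp add: form_simps)
  qed
  show "sym_psd X"
    and "lyapunov_eq (A - F ** X) (X ** F ** X + Q + (P - X) ** F ** (P - X)) X"
    and "stable (A - F ** X)"
    using policy_improvement[OF F Q S E st X' form kernel] by auto
qed

lemma newton_step_expand:
  assumes F: "sym_psd F" and P: "symmetric_mat P"
    and X: "lyapunov_eq (A - F ** P) (P ** F ** P + Q) X"
  shows "transpose A ** X + X ** A - P ** F ** X - X ** F ** P + P ** F ** P + Q = 0"
proof -
  have "(P *v x) \<bullet> y = x \<bullet> (P *v y)" for x y using P by (simp add: symmetric_mat_iff_form)
  with X show ?thesis
    by (simp add: lyapunov_eq_iff_form matrix_eq_iff_form form_simps sym_psd_symD[OF F] algebra_simps)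
qed

text \<open>From the first step on the iterates are positive semidefinite. The equations satisfied by two
  consecutive iterates with respect to the same closed loop differ by the square of
  \<open>newton_step\<close>, so the iterates decrease and hence converge. In the
  limit the iteration rule becomes the Riccati equation.\<close>

lemma newton_kleinman_converges:
  assumes F: "sym_psd F" and Q: "sym_psd Q" and P0: "symmetric_mat P0" and st: "stable (A - F ** P0)"
  shows "stable (A - F ** newton_kleinman A F Q P0 k)"
    and "\<exists>L. riccati_psd A F Q L \<and> newton_kleinman A F Q P0 \<longlonglongrightarrow> L"
proof -
  define p where "p = newton_kleinman A F Q P0"
  have p_0: "p 0 = P0" by (simp add: p_def)
  have p_Suc: "p (Suc k) = lyapunov_sol (A - F ** p k) (p k ** F ** p k + Q)" for k
    by (simp add: p_def Let_def)
  have inv: "symmetric_mat (p k) \<and> stable (A - F ** p k)" for k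
  proof (induction k)
    case 0 then show ?case using P0 st by (simp add: p_0)
  next
    case (Suc k)
    then show ?case
      using newton_step(1,3)[OF F Q _ _ lyapunov_sol_eq]
      by (simp add: p_Suc sym_psd_def)
  qed
  then show "stable (A - F ** newton_kleinman A F Q P0 k)" by (simp add: p_def)
  have eq: "lyapunov_eq (A - F ** p k) (p k ** F ** p k + Q) (p (Suc k))" for k
    unfolding p_Suc by (rule lyapunov_sol_eq[OF conjunct2[OF inv]])
  note step = newton_step[OF F Q conjunct1[OF inv] conjunct2[OF inv] eq]
  have "sym_psd (p (Suc k) - p (Suc (Suc k)))" for k
  proof (rule lyapunov_sym_psd)
    show "stable (A - F ** p (Suc k))" using inv by blast
    let ?E = "(p k - p (Suc k)) ** F ** (p k - p (Suc k))"
    show "lyapunov_eq (A - F ** p (Suc k)) ?E (p (Suc k) - p (Suc (Suc k)))"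
      by (rule lyapunov_eq_diff[OF step(2) eq])
    have "symmetric_mat (p k - p (Suc k))"
      using inv[of k] inv[of "Suc k"] by (simp add: symmetric_mat_iff_form form_simps)
    then show "sym_psd ?E" by (rule sym_psd_congruence_sym[OF F])
  qed
  with step(1) obtain L where L: "sym_psd L" "(\<lambda>k. p (Suc k)) \<longlonglongrightarrow> L"
    using sym_psd_mono_convergent[of "\<lambda>k. p (Suc k)"] by blast
  then have lim: "p \<longlonglongrightarrow> L" by (simp only: filterlim_sequentially_Suc)
  have "(\<lambda>k. transpose A ** p (Suc k) + p (Suc k) ** A - p k ** F ** p (Suc k)
      - p (Suc k) ** F ** p k + p k ** F ** p k + Q) \<longlonglongrightarrow>
      transpose A ** L + L ** A - L ** F ** L - L ** F ** L + L ** F ** L + Q"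
    by (intro tendsto_intros tendsto_matrix_mult L(2) lim)
  then have "transpose A ** L + L ** A - L ** F ** L - L ** F ** L + L ** F ** L + Q = 0"
    unfolding newton_step_expand[OF F conjunct1[OF inv] eq] by (simp only: LIMSEQ_const_iff)
  then have "riccati_psd A F Q L" using L(1) by (simp add: riccati_psd_def)
  with lim show "\<exists>L. riccati_psd A F Q L \<and> newton_kleinman A F Q P0 \<longlonglongrightarrow> L"
    unfolding p_def by blast
qed

section \<open>Square roots of positive semidefinite matrices\<close>

text \<open>A square root of \<open>Q\<close> is a solution of the Riccati equation with \<open>A = 0\<close> and \<open>F = I\<close>, for which
  the identity is a stabilizing initial guess.\<close>

lemma ex_sym_psd_sqrt:
  assumes Q: "sym_psd Q"
  shows "\<exists>S. sym_psd S \<and> S ** S = Q"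
proof -
  \<comment> \<open>The matrix is \<open>A - F P\<^sub>0 = -I\<close>, written as it occurs in the iteration.\<close>
  have "stable (0 - mat 1 ** mat 1 :: real ^ 'a ^ 'a)"
    unfolding stable_iff_real
  proof (intro allI impI)
    fix \<alpha> \<beta> :: real and a b :: "real ^ 'a"
    assume ab: "a \<noteq> 0 \<or> b \<noteq> 0" and "(0 - mat 1 ** mat 1) *v a = \<alpha> *\<^sub>R a - \<beta> *\<^sub>R b"
      "(0 - mat 1 ** mat 1) *v b = \<beta> *\<^sub>R a + \<alpha> *\<^sub>R b"
    then have a: "- a = \<alpha> *\<^sub>R a - \<beta> *\<^sub>R b" and b: "- b = \<beta> *\<^sub>R a + \<alpha> *\<^sub>R b"
      by (simp_all add: matrix_vector_mult_minus_left)
    have "- (a \<bullet> a) - b \<bullet> b = \<alpha> * (a \<bullet> a + b \<bullet> b)"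
      using arg_cong[OF a, of "(\<bullet>) a"] arg_cong[OF b, of "(\<bullet>) b"]
      by (simp add: inner_diff_right inner_add_right inner_commute[of b a] algebra_simps)
    moreover have "a \<bullet> a + b \<bullet> b > 0"
      using ab by (metis add_nonneg_pos add_pos_nonneg inner_ge_zero inner_gt_zero_iff)
    ultimately show "\<alpha> < 0" by (smt (verit) mult_nonneg_nonneg)
  qed
  then obtain L where "riccati_psd 0 (mat 1) Q L"
    using newton_kleinman_converges(2)[OF sym_psd_mat1 Q] sym_psd_mat1 by (metis sym_psd_def)
  then show ?thesis by (auto simp: riccati_psd_def transpose_def zero_vec_def[symmetric])
qed

lemma sym_psd_trace_eq_0:
  assumes X: "sym_psd X" and Y: "sym_psd Y" and D: "symmetric_mat D"
    and tr: "trace (D ** X ** D) + trace (D ** Y ** D) = 0"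
  shows "X ** D = 0" "Y ** D = 0"
proof -
  have tr_eq: "trace (D ** W ** D) = (\<Sum>i\<in>UNIV. (D *v axis i 1) \<bullet> (W *v (D *v axis i 1)))" for W
  proof -
    have "(D ** W ** D) $ i $ i = axis i 1 \<bullet> ((D ** W ** D) *v axis i 1)" for i
      by (simp add: inner_axis' matrix_vector_mult_basis column_def)
    moreover have "x \<bullet> ((D ** W ** D) *v x) = (D *v x) \<bullet> (W *v (D *v x))" for x
      using D by (simp add: form_simps symmetric_mat_iff_form)
    ultimately show ?thesis by (simp add: trace_def)
  qed
  have "W ** D = 0" if W: "sym_psd W" and 0: "trace (D ** W ** D) = 0" for W
  proof -
    have "(W ** D) *v axis i 1 = 0" for i
    proof -
      have "(D *v axis i 1) \<bullet> (W *v (D *v axis i 1)) = 0"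
        using 0 unfolding tr_eq
        by (subst (asm) sum_nonneg_eq_0_iff) (auto simp: sym_psd_nonneg[OF W])
      then show ?thesis using sym_psd_kernel[OF W] by (simp add: form_simps)
    qed
    then show ?thesis by (simp add: vec_eq_iff matrix_vector_mult_basis column_def)
  qed
  moreover have "trace (D ** X ** D) \<ge> 0" "trace (D ** Y ** D) \<ge> 0"
    unfolding tr_eq by (auto intro!: sum_nonneg sym_psd_nonneg X Y)
  ultimately show "X ** D = 0" "Y ** D = 0" using X Y tr by auto
qed

text \<open>With \<open>D = X - Y\<close> one has \<open>X D + D Y = X\<^sup>2 - Y\<^sup>2 = 0\<close>, so the traces of \<open>D X D\<close> and \<open>D Y D\<close> add up
  to zero. Both matrices are positive semidefinite, whence \<open>X D = Y D = 0\<close> and \<open>D\<^sup>2 = 0\<close>.\<close>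

lemma sym_psd_sqrt_unique:
  assumes X: "sym_psd X" and Y: "sym_psd Y" and eq: "X ** X = Y ** Y"
  shows "X = Y"
proof -
  define D where "D = X - Y"
  have sym: "symmetric_mat D"
    using X Y by (simp add: D_def symmetric_mat_iff_form form_simps sym_psd_symD)
  have "X *v (X *v x) = Y *v (Y *v x)" for x using eq by (simp add: matrix_vector_mul_assoc)
  then have "X ** D + D ** Y = 0"
    by (simp add: matrix_eq D_def form_simps)
  then have "D ** X ** D + D ** D ** Y = 0"
    by (metis matrix_add_ldistrib matrix_mul_assoc times0_right)
  then have "trace (D ** X ** D) + trace (D ** D ** Y) = 0"
    by (metis trace_add trace_0 mat_0)
  moreover have "trace (D ** D ** Y) = trace (D ** Y ** D)"
    by (metis trace_mul_sym matrix_mul_assoc)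
  ultimately have 0: "X ** D = 0" "Y ** D = 0"
    using sym_psd_trace_eq_0[OF X Y sym] by auto
  have "D *v x = 0" for x
  proof -
    have "D *v (D *v x) = X *v (D *v x) - Y *v (D *v x)" by (simp add: D_def form_simps)
    also have "\<dots> = 0" using 0 by (simp add: matrix_vector_mul_assoc)
    finally have "(D *v x) \<bullet> (D *v x) = 0" using sym by (simp add: symmetric_mat_iff_form)
    then show ?thesis by simp
  qed
  then have "D = 0" by (simp add: matrix_eq)
  then show ?thesis by (simp add: D_def)
qed

lemma psd_sqrt_props:
  assumes "sym_psd Q"
  shows "sym_psd (psd_sqrt Q)" "psd_sqrt Q ** psd_sqrt Q = Q"
proof -
  have "\<exists>!S. sym_psd S \<and> S ** S = Q"
    using ex_sym_psd_sqrt[OF assms] sym_psd_sqrt_unique by metis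
  from theI'[OF this] show "sym_psd (psd_sqrt Q)" "psd_sqrt Q ** psd_sqrt Q = Q"
    by (auto simp: psd_sqrt_def)
qed

text \<open>The only property of the square root that detectability requires: it vanishes wherever the
  quadratic form of \<open>Q\<close> does.\<close>

lemma psd_sqrt_kernel:
  assumes Q: "sym_psd Q" and x: "x \<bullet> (Q *v x) = 0"
  shows "psd_sqrt Q *v x = 0"
proof -
  have "Q *v x = psd_sqrt Q *v (psd_sqrt Q *v x)"
    using psd_sqrt_props(2)[OF Q] by (simp add: matrix_vector_mul_assoc)
  then have "(psd_sqrt Q *v x) \<bullet> (psd_sqrt Q *v x) = 0"
    using x psd_sqrt_props(1)[OF Q] by (simp add: sym_psd_symD)
  then show ?thesis by simp
qed

section \<open>The Riccati equation\<close>

lemma riccati_lyapunov: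
  assumes F: "sym_psd F" and X: "riccati_psd A F Q X"
  shows "lyapunov_eq (A - F ** X) (X ** F ** X + Q) X"
proof -
  have psd: "sym_psd X" using X by (simp add: riccati_psd_def)
  have "x \<bullet> ((transpose A ** X + X ** A - X ** F ** X + Q) *v y) = 0" for x y
    using X by (simp add: riccati_psd_def)
  then show ?thesis
    by (simp add: lyapunov_eq_iff_form form_simps sym_psd_symD[OF F] sym_psd_symD[OF psd] algebra_simps)
qed

text \<open>Detectability provides a stable matrix \<open>A - K\<^sup>T Q\<^sup>1\<^sup>/\<^sup>2\<close>. On vectors where the form of
  \<open>X F X + Q\<close> vanishes it coincides with \<open>A\<close>, and so does the closed loop \<open>A - F X\<close>.\<close>

lemma riccati_stabilizing:
  assumes F: "sym_psd F" and Q: "sym_psd Q" and det: "detectable A (psd_sqrt Q)"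
    and X: "riccati_psd A F Q X"
  shows "stable (A - F ** X)"
proof -
  obtain K where "stable (transpose A - transpose (psd_sqrt Q) ** K)"
    using det by (auto simp: detectable_def stabilizable_def)
  then have "stable (transpose (transpose A - transpose (psd_sqrt Q) ** K))"
    by (simp only: stable_transpose)
  also have "transpose (transpose A - transpose (psd_sqrt Q) ** K) = A - transpose K ** psd_sqrt Q"
  proof -
    have "transpose (U - V) = transpose U - transpose V" for U V :: "real ^ 'a ^ 'a"
      by (simp add: transpose_def vec_eq_iff)
    then show ?thesis by (simp add: matrix_transpose_mul)
  qed
  finally have st: "stable (A - transpose K ** psd_sqrt Q)" .
  have psd: "sym_psd X" using X by (simp add: riccati_psd_def)
  have XFX: "sym_psd (X ** F ** X)"
    using F psd by (intro sym_psd_congruence_sym) (auto simp: sym_psd_def)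
  show ?thesis
  proof (rule stable_transfer[OF st psd riccati_lyapunov[OF F X]])
    show "0 \<le> x \<bullet> ((X ** F ** X + Q) *v x)" for x
      using sym_psd_nonneg[OF sym_psd_add[OF XFX Q]] .
    fix x assume "x \<bullet> ((X ** F ** X + Q) *v x) = 0"
    then have 0: "x \<bullet> ((X ** F ** X) *v x) = 0" "x \<bullet> (Q *v x) = 0"
      using sym_psd_nonneg[OF XFX, of x] sym_psd_nonneg[OF Q, of x]
      by (simp_all add: matrix_vector_mult_add_rdistrib inner_add_right)
    from 0(1) have "(X *v x) \<bullet> (F *v (X *v x)) = 0"
      by (simp add: form_simps sym_psd_symD[OF psd])
    then have "F *v (X *v x) = 0" by (rule sym_psd_kernel[OF F])
    moreover have "psd_sqrt Q *v x = 0" by (rule psd_sqrt_kernel[OF Q 0(2)])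
    ultimately show "(A - F ** X) *v x = (A - transpose K ** psd_sqrt Q) *v x"
      by (simp add: matrix_vector_mult_diff_rdistrib matrix_vector_mul_assoc[symmetric])
  qed
qed

text \<open>With respect to the stable closed loop of \<open>X\<close>, the difference \<open>X - Y\<close> solves a Lyapunov equation
  with right-hand side \<open>(X - Y) F (X - Y)\<close>, so it is positive semidefinite. Exchanging the roles of
  \<open>X\<close> and \<open>Y\<close> shows the same for \<open>Y - X\<close>.\<close>

lemma riccati_unique:
  assumes F: "sym_psd F" and Q: "sym_psd Q" and det: "detectable A (psd_sqrt Q)"
    and X: "riccati_psd A F Q X" and Y: "riccati_psd A F Q Y"
  shows "X = Y"
proof -
  have *: "sym_psd (X - Y)" if X: "riccati_psd A F Q X" and Y: "riccati_psd A F Q Y" for X Y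
  proof (rule lyapunov_sym_psd)
    show "stable (A - F ** X)" by (rule riccati_stabilizing[OF F Q det X])
    have psd: "sym_psd X" "sym_psd Y" using X Y by (auto simp: riccati_psd_def)
    have "x \<bullet> ((transpose A ** X + X ** A - X ** F ** X + Q) *v y) = 0"
      "x \<bullet> ((transpose A ** Y + Y ** A - Y ** F ** Y + Q) *v y) = 0" for x y
      using X Y by (auto simp: riccati_psd_def)
    then show "lyapunov_eq (A - F ** X) ((X - Y) ** F ** (X - Y)) (X - Y)"
      by (simp add: lyapunov_eq_iff_form form_simps sym_psd_symD[OF F] psd[THEN sym_psd_symD]) 
         (smt (verit))
    show "sym_psd ((X - Y) ** F ** (X - Y))"
      by (rule sym_psd_congruence_sym[OF F])
        (simp add: symmetric_mat_iff_form form_simps psd[THEN sym_psd_symD])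
  qed
  have "x \<bullet> ((X - Y) *v x) = 0" for x
    using sym_psd_nonneg[OF *[OF X Y], of x] sym_psd_nonneg[OF *[OF Y X], of x]
    by (simp add: form_simps)
  then have "(X - Y) *v x = 0" for x using sym_psd_kernel[OF *[OF X Y]] by blast
  then show ?thesis by (simp add: matrix_eq form_simps)
qed

lemma sym_pd_imp_sym_psd: "sym_pd R \<Longrightarrow> sym_psd R"
  by (metis inner_zero_left less_eq_real_def sym_pd_def sym_psd_def)

lemma sym_pd_inverse:
  fixes R :: "real ^ 'm ^ 'm"
  assumes R: "sym_pd R"
  shows "R ** matrix_inv R = mat 1" "sym_psd (matrix_inv R)"
proof -
  have "x = 0" if "R *v x = 0" for x
    using R that by (metis inner_zero_right less_irrefl sym_pd_def)
  then have "invertible R" by (simp add: invertible_left_inverse matrix_left_invertible_ker)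
  then have "R ** matrix_inv R = mat 1 \<and> matrix_inv R ** R = mat 1"
    unfolding invertible_def matrix_inv_def by (rule someI_ex)
  then show inv: "R ** matrix_inv R = mat 1" by blast
  then have x: "R *v (matrix_inv R *v x) = x" for x by (simp add: matrix_vector_mul_assoc)
  note psd = sym_pd_imp_sym_psd[OF R]
  show "sym_psd (matrix_inv R)"
  proof (rule sym_psdI)
    show "(matrix_inv R *v x) \<bullet> y = x \<bullet> (matrix_inv R *v y)" for x y
      using sym_psd_symD[OF psd, of "matrix_inv R *v x" "matrix_inv R *v y"] by (simp add: x)
    show "0 \<le> x \<bullet> (matrix_inv R *v x)" for x
      using sym_psd_nonneg[OF psd, of "matrix_inv R *v x"] by (simp add: x inner_commute)
  qed
qed

lemma sym_psd_control_weight: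
  fixes B :: "real ^ 'm ^ 'n"
  assumes R: "sym_pd R"
  shows "sym_psd (B ** matrix_inv R ** transpose B)"
  using sym_psd_congruence[OF sym_pd_inverse(2)[OF R], of "transpose B"] by simp

text \<open>One policy improvement step turns an arbitrary stabilizing feedback \<open>K\<close> into a stabilizing
  feedback of the form \<open>R\<^sup>-\<^sup>1 B\<^sup>T X\<close>, from which the Newton--Kleinman iteration can start. The
  completed square is weighted by \<open>R\<close> and taken of \<open>K - T\<close>, where \<open>T = R\<^sup>-\<^sup>1 B\<^sup>T X\<close>.\<close>

lemma riccati_exists:
  fixes B :: "real ^ 'm ^ 'n"
  assumes R: "sym_pd R" and F_eq: "F = B ** matrix_inv R ** transpose B" and Q: "sym_psd Q"
    and stab: "stabilizable A B"
  shows "\<exists>X. riccati_psd A F Q X"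
proof -
  obtain K where st: "stable (A - B ** K)" using stab by (auto simp: stabilizable_def)
  have F: "sym_psd F" unfolding F_eq by (rule sym_psd_control_weight[OF R])
  note Rpsd = sym_pd_imp_sym_psd[OF R]
  let ?S = "transpose K ** R ** K"
  have S: "sym_psd ?S" by (rule sym_psd_congruence[OF Rpsd])
  obtain X where X: "lyapunov_eq (A - B ** K) (Q + ?S) X" using lyapunov_ex1[OF st] by blast
  have psd: "sym_psd X"
    by (rule lyapunov_sym_psd[OF st X]) (intro sym_psd_add Q S)
  define T where "T = matrix_inv R ** transpose B ** X"
  let ?E = "transpose (K - T) ** R ** (K - T)"
  have E: "sym_psd ?E" by (rule sym_psd_congruence[OF Rpsd])
  have RT: "R *v (T *v y) = transpose B *v (X *v y)" for y
    using sym_pd_inverse(1)[OF R] by (simp add: T_def matrix_vector_mul_assoc matrix_mul_assoc)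
  have BT: "B *v (T *v y) = F *v (X *v y)" for y
    by (simp add: T_def F_eq matrix_vector_mul_assoc matrix_mul_assoc)
  have form: "x \<bullet> (?E *v y) = x \<bullet> (?S *v y) - ((B ** K) *v x) \<bullet> (X *v y)
      - x \<bullet> (X *v ((B ** K) *v y)) + x \<bullet> (X *v (F *v (X *v y)))" for x y
  proof -
    have 1: "(T *v x) \<bullet> (R *v (K *v y)) = x \<bullet> (X *v (B *v (K *v y)))"
    proof -
      have "(T *v x) \<bullet> (R *v (K *v y)) = (K *v y) \<bullet> (R *v (T *v x))"
        by (metis Rpsd sym_psd_symD inner_commute)
      also have "\<dots> = x \<bullet> (X *v (B *v (K *v y)))"
        unfolding RT inner_transpose by (metis psd sym_psd_symD inner_commute)
      finally show ?thesis .
    qed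
    have 2: "(T *v x) \<bullet> (R *v (T *v y)) = x \<bullet> (X *v (F *v (X *v y)))"
      unfolding RT inner_transpose BT by (simp add: sym_psd_symD[OF F] sym_psd_symD[OF psd])
    have 3: "(K *v x) \<bullet> (R *v (T *v y)) = (B *v (K *v x)) \<bullet> (X *v y)"
      unfolding RT inner_transpose ..
    show ?thesis by (simp add: form_simps 1 2 3)
  qed
  have kernel: "(B ** K) *v x = F *v (X *v x)" if "x \<bullet> (?E *v x) = 0" for x
  proof -
    have "((K - T) *v x) \<bullet> (R *v ((K - T) *v x)) = 0"
      using that by (simp add: form_simps)
    then have "(K - T) *v x = 0" using R by (metis sym_pd_def less_irrefl)
    then have "K *v x = T *v x" by (simp add: form_simps)
    then show ?thesis by (simp add: BT[symmetric] matrix_vector_mul_assoc[symmetric])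
  qed
  have "stable (A - F ** X)"
    by (rule policy_improvement(3)[OF F Q S E st X form kernel])
  then show ?thesis
    using newton_kleinman_converges(2)[OF F Q] psd by (metis sym_psd_def)
qed

section \<open>Decay of the velocity along trajectories\<close>

text \<open>Restriction of the supremum to real vectors. The Cauchy--Schwarz inequality bounds the
  quotients, without which the supremum would be an arbitrary number.\<close>

lemma inner_le_logm:
  fixes M :: "real ^ 'n ^ 'n"
  shows "x \<bullet> (M *v x) \<le> logm (complex_mat M) * (norm x)\<^sup>2"
proof (cases "x = 0")
  case False
  let ?f = "\<lambda>v. Re (hermitian_inner (complex_mat M *v v) v) / (norm v)\<^sup>2"
  have herm: "Re (hermitian_inner u v) = u \<bullet> v" for u v :: "complex ^ 'n"
    by (simp add: hermitian_inner_def inner_vec_def inner_complex_def)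
  have bdd: "bdd_above (?f ` (UNIV - {0}))"
  proof (rule bdd_aboveI2)
    fix v :: "complex ^ 'n"
    assume "v \<in> UNIV - {0}"
    then have v: "norm v > 0" by simp
    have "(complex_mat M *v v) \<bullet> v \<le> norm (complex_mat M *v v) * norm v"
      by (rule norm_cauchy_schwarz)
    also have "\<dots> \<le> (onorm ((*v) (complex_mat M)) * norm v) * norm v"
      by (intro mult_right_mono onorm matrix_vector_mul_bounded_linear norm_ge_zero)
    finally show "?f v \<le> onorm ((*v) (complex_mat M))"
      unfolding herm using v by (simp add: divide_le_eq power2_eq_square mult.assoc)
  qed
  let ?v = "\<chi> i. complex_of_real (x $ i)"
  have norm_v: "norm ?v = norm x" by (simp add: norm_vec_def)
  have Mv: "complex_mat M *v ?v = (\<chi> i. complex_of_real ((M *v x) $ i))"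
    by (simp add: vec_eq_iff matrix_vector_mult_def)
  have "?v \<in> UNIV - {0}" using False by (simp add: vec_eq_iff)
  then have "?f ?v \<le> logm (complex_mat M)"
    unfolding logm_def by (rule cSUP_upper[OF _ bdd])
  moreover have "Re (hermitian_inner (complex_mat M *v ?v) ?v) = x \<bullet> (M *v x)"
    unfolding herm Mv by (simp add: inner_vec_def inner_complex_def mult.commute)
  ultimately have "x \<bullet> (M *v x) / (norm x)\<^sup>2 \<le> logm (complex_mat M)"
    by (simp only: norm_v)
  then show ?thesis using False by (simp add: pos_divide_le_eq)
qed simp

text \<open>This is what the matrix \<open>grad_apply M x\<close> is for: it represents the map
  \<open>v \<mapsto> DM(x)[v] x\<close>.\<close>

lemma derivative_apply_eq_grad_apply:
  fixes M :: "real ^ 'n \<Rightarrow> real ^ 'n ^ 'n"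
  assumes D: "(M has_derivative D) (at x)"
  shows "D v *v x = grad_apply M x *v v"
proof -
  have lin: "linear D" using D by (rule has_derivative_linear)
  have partial: "partial_deriv i M x = D (axis i 1)" for i
  proof -
    have "((\<lambda>s. x + s *\<^sub>R axis i 1) has_derivative (\<lambda>s. s *\<^sub>R axis i 1)) (at (0 :: real))"
      by (auto intro!: derivative_eq_intros)
    then have "((\<lambda>s. M (x + s *\<^sub>R axis i 1)) has_derivative (\<lambda>s. D (s *\<^sub>R axis i 1))) (at 0)"
      using D by (intro has_derivative_compose[of _ _ 0 UNIV M D]) auto
    then have "((\<lambda>s. M (x + s *\<^sub>R axis i 1)) has_vector_derivative D (axis i 1)) (at 0)"
      by (simp add: has_vector_derivative_def linear_scale[OF lin])
    then show ?thesis unfolding partial_deriv_def by (rule vector_derivative_at)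
  qed
  have "D v = D (\<Sum>i\<in>UNIV. v $ i *\<^sub>R axis i 1)"
    using basis_expansion[of v] by (simp add: scalar_mult_eq_scaleR)
  also have "\<dots> = (\<Sum>i\<in>UNIV. v $ i *\<^sub>R D (axis i 1))"
    by (simp add: linear_sum[OF lin] linear_scale[OF lin])
  finally have "(D v *v x) $ k = (\<Sum>i\<in>UNIV. v $ i * (D (axis i 1) *v x) $ k)" for k
    by (simp add: matrix_vector_mult_def sum_distrib_right sum_distrib_left mult.assoc)
      (rule sum.swap)
  then show ?thesis
    by (simp add: vec_eq_iff grad_apply_def partial)
      (simp add: matrix_vector_mult_def mult.commute)
qed

lemma bounded_bilinear_matrix_vector_mult:
  "bounded_bilinear ((*v) :: real ^ 'n ^ 'm \<Rightarrow> real ^ 'n \<Rightarrow> real ^ 'm)"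
  unfolding bilinear_conv_bounded_bilinear[symmetric] bilinear_def
  by (auto intro!: linearI simp: form_simps matrix_vector_mult_scaleR
      scaleR_matrix_vector_assoc[symmetric])

text \<open>The velocity \<open>v = M(y) y\<close> of a trajectory satisfies the linear equation
  \<open>v' = (M(y) + (\<nabla>M(y)) y) v\<close>. The logarithmic norms bound the derivative of \<open>\<bar>v\<bar>\<^sup>2\<close>, and by the
  sign condition \<open>\<bar>v\<bar>\<close> cannot grow.\<close>

lemma velocity_norm_le:
  fixes M :: "real ^ 'n \<Rightarrow> real ^ 'n ^ 'n"
  assumes \<Omega>: "open \<Omega>" and diff: "M differentiable_on \<Omega>"
    and logm: "\<And>x. x \<in> \<Omega> \<Longrightarrow> logm (complex_mat (M x)) + logm (complex_mat (grad_apply M x)) \<le> 0"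
    and traj: "\<And>s. s \<in> {0..T} \<Longrightarrow> y s \<in> \<Omega>"
    and ode: "\<And>s. s \<in> {0..T} \<Longrightarrow> (y has_vector_derivative M (y s) *v y s) (at s within {0..T})"
    and s: "s \<in> {0..T}"
  shows "norm (M (y s) *v y s) \<le> norm (M (y 0) *v y 0)"
proof -
  define v where "v s = M (y s) *v y s" for s
  let ?v' = "\<lambda>r. M (y r) *v v r + grad_apply M (y r) *v v r"
  have v': "(v has_vector_derivative ?v' r) (at r within {0..T})" if r: "r \<in> {0..T}" for r
  proof -
    obtain D where D: "(M has_derivative D) (at (y r))"
      using diff \<Omega> traj[OF r] unfolding differentiable_on_def differentiable_def
      by (metis at_within_open)
    have lin: "linear D" using D by (rule has_derivative_linear)
    have y': "(y has_vector_derivative v r) (at r within {0..T})"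
      using ode[OF r] by (simp add: v_def)
    have "((\<lambda>r. M (y r)) has_vector_derivative D (v r)) (at r within {0..T})"
      using has_derivative_compose[OF y'[unfolded has_vector_derivative_def] D]
      by (simp add: has_vector_derivative_def linear_scale[OF lin])
    from bounded_bilinear.has_vector_derivative[OF bounded_bilinear_matrix_vector_mult this y']
    show ?thesis
      unfolding v_def[abs_def, symmetric] derivative_apply_eq_grad_apply[OF D] .
  qed
  have energy: "((\<lambda>r. v r \<bullet> v r) has_vector_derivative 2 * (v r \<bullet> ?v' r)) (at r within {0..T})"
    if r: "r \<in> {0..T}" for r
    using bounded_bilinear.has_vector_derivative[OF bounded_bilinear_inner v'[OF r] v'[OF r]]
    by (simp add: inner_commute)
  have "v s \<bullet> v s \<le> v 0 \<bullet> v 0"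
  proof (rule DERIV_nonpos_imp_decreasing_open[of 0 s "\<lambda>r. v r \<bullet> v r"])
    show "0 \<le> s" using s by simp
    have "continuous_on {0..T} (\<lambda>r. v r \<bullet> v r)"
      by (rule continuous_on_vector_derivative[OF energy])
    then show "continuous_on {0..s} (\<lambda>r. v r \<bullet> v r)"
      by (rule continuous_on_subset) (use s in auto)
    fix r assume r: "0 < r" "r < s"
    with s have "r \<in> {0..T}" "r \<in> {0<..<T}" by simp_all
    then have "at r within {0..T} = at r"
      by (intro at_within_interior) (simp add: interior_atLeastAtMost_real)
    with energy[OF \<open>r \<in> {0..T}\<close>]
    have "((\<lambda>r. v r \<bullet> v r) has_real_derivative 2 * (v r \<bullet> ?v' r)) (at r)"
      by (simp only: has_real_derivative_iff_has_vector_derivative)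
    moreover have "v r \<bullet> ?v' r \<le> 0"
    proof -
      have "v r \<bullet> ?v' r \<le> (logm (complex_mat (M (y r))) + logm (complex_mat (grad_apply M (y r)))) * (norm (v r))\<^sup>2"
        using inner_le_logm[of "v r" "M (y r)"] inner_le_logm[of "v r" "grad_apply M (y r)"]
        by (simp add: inner_add_right distrib_right)
      also have "\<dots> \<le> 0"
        using logm[OF traj[OF \<open>r \<in> {0..T}\<close>]] by (simp add: mult_nonpos_nonneg)
      finally show ?thesis .
    qed
    ultimately show "\<exists>d. ((\<lambda>r. v r \<bullet> v r) has_real_derivative d) (at r) \<and> d \<le> 0" by force
  qed
  then show ?thesis by (simp add: v_def norm_le)
qed

lemma displacement_le:
  fixes y :: "real \<Rightarrow> 'a::real_normed_vector"
  assumes "0 \<le> a" "a \<le> b"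
    and der: "\<And>s. s \<in> {0..b} \<Longrightarrow> (y has_vector_derivative v s) (at s within {0..b})"
    and bound: "\<And>s. s \<in> {0..b} \<Longrightarrow> norm (v s) \<le> C"
  shows "norm (y b - y a) \<le> C * (b - a)"
proof -
  have "norm (y b - y a) \<le> C * norm (b - a)"
  proof (rule differentiable_bound[of "{0..b}" y "\<lambda>s h. h *\<^sub>R v s"])
    show "(y has_derivative (\<lambda>h. h *\<^sub>R v s)) (at s within {0..b})" if "s \<in> {0..b}" for s
      using der[OF that] by (simp add: has_vector_derivative_def)
    show "onorm (\<lambda>h. h *\<^sub>R v s) \<le> C" if "s \<in> {0..b}" for s
      by (rule onorm_le) (use bound[OF that] in \<open>simp add: mult.commute[of C] mult_left_mono\<close>)
  qed (use assms in auto)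
  then show ?thesis using assms by simp
qed

section \<open>Warm starts along a trajectory\<close>

lemma norm_le_op_norm: "norm (M *v x) \<le> op_norm M * norm x"
  unfolding op_norm_def by (rule onorm) (rule matrix_vector_mul_bounded_linear)

lemma op_norm_nonneg: "0 \<le> op_norm M"
  unfolding op_norm_def by (rule onorm_pos_le) (rule matrix_vector_mul_bounded_linear)

text \<open>The solution \<open>H\<close> of the Lyapunov equation of \<open>M\<close> remains a strict Lyapunov matrix for \<open>M + E\<close>:
  the perturbation changes the right-hand side \<open>-I\<close> by at most \<open>2 \<parallel>E\<parallel> \<parallel>H\<parallel> < 1\<close>.\<close>

lemma stable_perturbation:
  assumes M: "stable M" and small: "2 * op_norm E * op_norm (lyapunov_sol M (mat 1)) < 1"
  shows "stable (M + E)"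
proof -
  define H where "H = lyapunov_sol M (mat 1)"
  have eq: "lyapunov_eq M (mat 1) H" unfolding H_def by (rule lyapunov_sol_eq[OF M])
  have psd: "sym_psd H" by (rule lyapunov_sym_psd[OF M eq sym_psd_mat1])
  let ?W = "mat 1 - transpose E ** H - H ** E"
  have pos: "x \<bullet> (?W *v x) > 0" if "x \<noteq> 0" for x
  proof -
    have "x \<bullet> (?W *v x) = (norm x)\<^sup>2 - 2 * ((E *v x) \<bullet> (H *v x))"
      using sym_psd_symD[OF psd, of x "E *v x"]
      by (simp add: form_simps power2_norm_eq_inner inner_commute[of "H *v x"])
    moreover have "(E *v x) \<bullet> (H *v x) \<le> (op_norm E * norm x) * (op_norm H * norm x)"
      by (rule order.trans[OF norm_cauchy_schwarz])
        (intro mult_mono norm_le_op_norm mult_nonneg_nonneg op_norm_nonneg norm_ge_zero)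
    moreover have "(2 * op_norm E * op_norm H) * (norm x)\<^sup>2 < 1 * (norm x)\<^sup>2"
      using small that by (intro mult_strict_right_mono) (auto simp: H_def)
    ultimately show ?thesis by (simp add: power2_eq_square mult_ac)
  qed
  show ?thesis
  proof (rule stable_transfer[OF M psd])
    show "lyapunov_eq (M + E) ?W H"
      using eq by (simp add: lyapunov_eq_iff_form form_simps algebra_simps)
    show "0 \<le> x \<bullet> (?W *v x)" for x using pos[of x] by (cases "x = 0") auto
    show "(M + E) *v x = M *v x" if "x \<bullet> (?W *v x) = 0" for x
      using pos[of x] that by (cases "x = 0") auto
  qed
qed

theorem proposition3p7:
  fixes \<Omega> :: "(real ^ 'd) set" and \<P> :: "'p set"
    and A :: "real ^ 'd \<Rightarrow> real ^ 'd ^ 'd" and B :: "real ^ 'm ^ 'd"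
    and Q :: "real ^ 'd ^ 'd" and R :: "real ^ 'm ^ 'm" and F :: "real ^ 'd ^ 'd"
    and P A\<^sub>c\<^sub>l :: "real ^ 'd \<Rightarrow> real ^ 'd ^ 'd"
    and y\<^sub>0 :: "'p \<Rightarrow> real ^ 'd" and y :: "'p \<Rightarrow> real \<Rightarrow> real ^ 'd"
    and L\<^sub>A t \<Delta>t :: real and \<mu> :: 'p and H :: "real ^ 'd ^ 'd"
  assumes domain: "open \<Omega>" "connected \<Omega>" "\<Omega> \<noteq> {}"
    and Q: "sym_psd Q" and R: "sym_pd R"
    and F_eq: "F = B ** matrix_inv R ** transpose B"
    and P_eq: "P = (\<lambda>x. riccati_sol (A x) F Q)"
    and Acl_eq: "A\<^sub>c\<^sub>l = (\<lambda>x. A x - F ** P x)"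
    and diff: "A\<^sub>c\<^sub>l differentiable_on \<Omega>"
    and stab: "\<forall>x\<in>\<Omega>. stabilizable (A x) B"
    and detect: "\<forall>x\<in>\<Omega>. detectable (A x) (psd_sqrt Q)"
    and L_pos: "0 < L\<^sub>A"
    and lipschitz: "\<forall>x\<in>\<Omega>. \<forall>z\<in>\<Omega>. op_norm (A x - A z) \<le> L\<^sub>A * norm (x - z)"
    and logm_neg: "\<forall>x\<in>\<Omega>. logm (complex_mat (A\<^sub>c\<^sub>l x)) + logm (complex_mat (grad_apply A\<^sub>c\<^sub>l x)) < 0"
    and init: "\<forall>\<nu>\<in>\<P>. y\<^sub>0 \<nu> \<in> \<Omega>"
    and mu: "\<mu> \<in> \<P>" and t: "0 \<le> t" and dt_pos: "0 < \<Delta>t"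
    and traj_init: "y \<mu> 0 = y\<^sub>0 \<mu>"
    and traj_in: "\<forall>s\<in>{0..t + \<Delta>t}. y \<mu> s \<in> \<Omega>"
    and traj_ode: "\<forall>s\<in>{0..t + \<Delta>t}.
          (y \<mu> has_vector_derivative A\<^sub>c\<^sub>l (y \<mu> s) *v y \<mu> s) (at s within {0..t + \<Delta>t})"
    and H_eq: "H = lyapunov_sol (A (y \<mu> t) - F ** P (y \<mu> t)) (mat 1)"
    and dt_bound: "A\<^sub>c\<^sub>l (y \<mu> 0) *v y \<mu> 0 \<noteq> 0 \<longrightarrow>
          \<Delta>t < 1 / (2 * L\<^sub>A * norm (A\<^sub>c\<^sub>l (y \<mu> 0) *v y \<mu> 0) * op_norm H)"
  shows "stable (A (y \<mu> (t + \<Delta>t)) - F ** P (y \<mu> t)) \<and>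
    (let A' = A (y \<mu> (t + \<Delta>t)); P_seq = newton_kleinman A' F Q (P (y \<mu> t)) in
       (\<forall>k. \<exists>!X. lyapunov_eq (A' - F ** P_seq k) (P_seq k ** F ** P_seq k + Q) X) \<and>
       (\<exists>!X. riccati_psd A' F Q X) \<and>
       P_seq \<longlonglongrightarrow> P (y \<mu> (t + \<Delta>t)))"
proof -
  let ?T = "t + \<Delta>t"
  define v\<^sub>0 where "v\<^sub>0 = A\<^sub>c\<^sub>l (y \<mu> 0) *v y \<mu> 0"
  have F: "sym_psd F" unfolding F_eq by (rule sym_psd_control_weight[OF R])
  have in_\<Omega>: "y \<mu> s \<in> \<Omega>" if "0 \<le> s" "s \<le> ?T" for s using traj_in that by auto
  have ric: "\<exists>!X. riccati_psd (A x) F Q X" if x: "x \<in> \<Omega>" for x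
  proof -
    obtain X where X: "riccati_psd (A x) F Q X"
      using riccati_exists[OF R F_eq Q bspec[OF stab x]] by blast
    then show ?thesis by (rule ex1I) (rule riccati_unique[OF F Q bspec[OF detect x] _ X])
  qed
  have P: "riccati_psd (A x) F Q (P x)" if "x \<in> \<Omega>" for x
    unfolding P_eq riccati_sol_def by (rule theI'[OF ric[OF that]])
  have P_stab: "stable (A x - F ** P x)" if "x \<in> \<Omega>" for x
    by (rule riccati_stabilizing[OF F Q bspec[OF detect that] P[OF that]])
  have t_in: "y \<mu> t \<in> \<Omega>" and T_in: "y \<mu> ?T \<in> \<Omega>" using in_\<Omega> t dt_pos by auto
  have "norm (y \<mu> ?T - y \<mu> t) \<le> norm v\<^sub>0 * (?T - t)"
  proof (rule displacement_le)
    show "(y \<mu> has_vector_derivative A\<^sub>c\<^sub>l (y \<mu> s) *v y \<mu> s) (at s within {0..?T})"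
      if "s \<in> {0..?T}" for s using traj_ode that by blast
    show "norm (A\<^sub>c\<^sub>l (y \<mu> s) *v y \<mu> s) \<le> norm v\<^sub>0" if "s \<in> {0..?T}" for s
      unfolding v\<^sub>0_def
      by (rule velocity_norm_le[OF domain(1) diff _ _ _ that])
        (use logm_neg traj_in traj_ode in \<open>auto simp: less_imp_le\<close>)
  qed (use t dt_pos in auto)
  then have "L\<^sub>A * norm (y \<mu> ?T - y \<mu> t) \<le> L\<^sub>A * (norm v\<^sub>0 * \<Delta>t)"
    using L_pos by (intro mult_left_mono) simp_all
  moreover have "op_norm (A (y \<mu> ?T) - A (y \<mu> t)) \<le> L\<^sub>A * norm (y \<mu> ?T - y \<mu> t)"
    using lipschitz t_in T_in by blast
  ultimately have "op_norm (A (y \<mu> ?T) - A (y \<mu> t)) \<le> L\<^sub>A * (norm v\<^sub>0 * \<Delta>t)"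
    by linarith
  from mult_right_mono[OF this op_norm_nonneg[of H]]
  have "2 * op_norm (A (y \<mu> ?T) - A (y \<mu> t)) * op_norm H \<le> \<Delta>t * (2 * L\<^sub>A * norm v\<^sub>0 * op_norm H)"
    by (simp add: mult_ac)
  also have "\<dots> < 1"
  proof (cases "v\<^sub>0 = 0")
    case False
    then have bound: "\<Delta>t < 1 / (2 * L\<^sub>A * norm v\<^sub>0 * op_norm H)" using dt_bound by (simp add: v\<^sub>0_def)
    \<comment> \<open>Division by zero yields zero, so the bound on the timestep excludes \<open>op_norm H = 0\<close>.\<close>
    with dt_pos have "0 < 2 * L\<^sub>A * norm v\<^sub>0 * op_norm H"
      by (metis less_trans zero_less_divide_1_iff)
    with bound show ?thesis by (simp only: less_divide_eq if_True)
  qed simp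
  finally have "stable ((A (y \<mu> t) - F ** P (y \<mu> t)) + (A (y \<mu> ?T) - A (y \<mu> t)))"
    unfolding H_eq by (rule stable_perturbation[OF P_stab[OF t_in]])
  then have start: "stable (A (y \<mu> ?T) - F ** P (y \<mu> t))" by (simp add: algebra_simps)
  have sym: "symmetric_mat (P (y \<mu> t))"
    using P[OF t_in] by (simp add: riccati_psd_def sym_psd_def)
  let ?N = "newton_kleinman (A (y \<mu> ?T)) F Q (P (y \<mu> t))"
  have "\<exists>!X. lyapunov_eq (A (y \<mu> ?T) - F ** ?N k) (?N k ** F ** ?N k + Q) X" for k
    by (rule lyapunov_ex1[OF newton_kleinman_converges(1)[OF F Q sym start]])
  moreover have "?N \<longlonglongrightarrow> P (y \<mu> ?T)"
    using newton_kleinman_converges(2)[OF F Q sym start] ric[OF T_in] P[OF T_in] by blast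
  ultimately show ?thesis using start ric[OF T_in] by (simp add: Let_def)
qed

end
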